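(* Let $(E,(\cdot,\cdot),\mathcal H)$ be an extended affine Lie algebra (of reduced type) with root system $R$ of type $B_\ell$ ($\ell\geq2$) with $\mathrm{ind}(R)=0$. Assume that $\Psi$ is a finite order Cartan automorphism of $E$. Then the corresponding map $\psi:R\to\mathbb C^\times$ is a character.
   Context: All vector spaces are over $\mathbb C$. An extended affine Lie algebra is a triple $(E,(\cdot,\cdot),\mathcal H)$ where $E$ is a Lie algebra, $\mathcal H$ is a non-trivial finite dimensional subalgebra and $(\cdot,\cdot)$ is a symmetric bilinear form on $E$ such that: (A1) the form is invariant and non-degenerate; (A2) $E=\sum_{\alpha\in R}E_\alpha$ with $E_\alpha=\{x\in E\mid [h,x]=\alpha(h)x\ \forall h\in\mathcal H\}$, $R=\{\alpha\in\mathcal H^\star\mid E_\alpha\neq\{0\}\}$ and $E_0=\mathcal H$ ($R$ is the root system of $E$); the form restricted to $\mathcal H$ is then non-degenerate, $t_\alpha\in\mathcal H$ is defined by $\alpha(h)=(h,t_\alpha)$, and $(\alpha,\beta):=(t_\alpha,t_\beta)$ on $\mathcal H^\star$; $R^0=\{\alpha\in R\mid(\alpha,\alpha)=0\}$ (isotropic roots), $R^\times=R\setminus R^0$ (non-isotropic roots), and the core $E_c$ is the subalgebra generated by $E_\alpha$, $\alpha\in R^\times$; (A3) $\mathrm{ad}(x)$ is locally nilpotent for $x\in E_\alpha$, $\alpha\in R^\times$; (A4) (tameness) the centralizer of $E_c$ in $E$ is contained in $E_c$; (A5) the $\mathbb Z$-span of $R$ is a free abelian group of finite rank; (A6) if $R^\times=R_1\uplus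 R_2$ with $R_1,R_2$ non-empty then $R_1\not\perp R_2$. Let $\mathcal V=\mathrm{span}_{\mathbb R}R$, $\mathcal V^0=\mathrm{span}_{\mathbb R}R^0$. The image $\bar R$ of $R$ in $\mathcal V/\mathcal V^0$ is an irreducible finite root system; its rank and type are called the rank and type of $R$ (and of $E$). Reduced type means $\bar R$ is reduced. The nullity of $R$ is $\dim\mathcal V^0$, and $\langle R\rangle$ denotes the $\mathbb Z$-span of $R$, a free abelian group of rank $\mathrm{rank}(R)+\mathrm{null}(R)$. Index: for $\alpha\in R^\times$ let $w_\alpha(\beta)=\beta-\frac{2(\alpha,\beta)}{(\alpha,\alpha)}\alpha$. For $\mathcal P\subseteq R^\times$ let $\mathcal W_{\mathcal P}$ be the group generated by $w_\alpha$, $\alpha\in\mathcal P$. A reflectable base is a subset $\mathcal P\subseteq R^\times$ with $\mathcal W_{\mathcal P}\mathcal P=R^\times$ such that no proper subset of $\mathcal P$ has this property (reflectable bases are finite). $\mathrm{refl}(R)$ is the smallest cardinality of a reflectable base, and $\mathrm{ind}(R):=\mathrm{refl}(R)-\mathrm{rank}\langle R\rangle$. A Cartan automorphism of $E$ is an automorphism $\Psi$ with $\Psi(h)=h$ for all $h\in\mathcal H$; it stabilizes each root space. For $\alpha\in R^\times$ ($\dim E_\alpha=1$) define $\eta_\alpha\in\mathbb C^\times$ by $\Psi(x)=\eta_\alpha x$, $x\in E_\alpha$. The map $\psi$ corresponding to $\Psi$ is $\psi:R\to\mathbb C^\times$, $\psi(\alpha)=\eta_\alpha$, where for $\sigma\in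 R^0$, $\eta_\sigma:=\eta_{\alpha+\sigma}\eta_{-\alpha}$ for some $\alpha\in R^\times$ with $\alpha+\sigma\in R^\times$ (such $\alpha$ exists; in type $B_\ell$ with $\mathrm{ind}(R)=0$ the value does not depend on its choice). A map $\psi:R\to\mathbb C^\times$ is a character if $\psi(\alpha+\beta)=\psi(\alpha)\psi(\beta)$ whenever $\alpha,\beta,\alpha+\beta\in R$. *)

theory Defs
  imports
    Complex_Main
    "HOL-Library.Function_Algebras"
    "HOL-Library.Set_Algebras"
    "HOL-Library.Extended_Real"
    "HOL-Algebra.Bij"
    "HOL-Algebra.Generated_Groups"
begin

section \<open>Scalar multiplication of complex-valued functions\<close>

definition real_scale :: "real \<Rightarrow> ('a \<Rightarrow> complex) \<Rightarrow> ('a \<Rightarrow> complex)" where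
  "real_scale r f = (\<lambda>x. complex_of_real r * f x)"

definition int_scale :: "int \<Rightarrow> ('a \<Rightarrow> complex) \<Rightarrow> ('a \<Rightarrow> complex)" where
  "int_scale n f = (\<lambda>x. of_int n * f x)"

definition complex_scale :: "complex \<Rightarrow> ('a \<Rightarrow> complex) \<Rightarrow> ('a \<Rightarrow> complex)" where
  "complex_scale c f = (\<lambda>x. c * f x)"

lemma vector_space_real_scale: "vector_space real_scale"
  by unfold_locales (auto simp: real_scale_def fun_eq_iff algebra_simps)

lemma module_int_scale: "module int_scale"
  by unfold_locales (auto simp: int_scale_def fun_eq_iff algebra_simps)

abbreviation real_span :: "('a \<Rightarrow> complex) set \<Rightarrow> ('a \<Rightarrow> complex) set" where
  "real_span \<equiv> module.span real_scale"

abbreviation int_span :: "('a \<Rightarrow> complex) set \<Rightarrow> ('a \<Rightarrow> complex) set" where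
  "int_span \<equiv> module.span int_scale"

definition int_basis :: "('a \<Rightarrow> complex) set \<Rightarrow> ('a \<Rightarrow> complex) set \<Rightarrow> bool" where
  "int_basis G B \<longleftrightarrow> \<not> module.dependent int_scale B \<and> int_span B = G"

definition free_of_finite_rank :: "('a \<Rightarrow> complex) set \<Rightarrow> bool" where
  "free_of_finite_rank G \<longleftrightarrow> (\<exists>B. finite B \<and> int_basis G B)"

definition int_rank :: "('a \<Rightarrow> complex) set \<Rightarrow> nat" where
  "int_rank G = card (SOME B. finite B \<and> int_basis G B)"


section \<open>The finite root system of type B\<close>

text \<open>Real \<open>l\<close>-space is modelled by the functions on the naturals that vanish from \<open>l\<close> on.\<close>

definition real_space :: "nat \<Rightarrow> (nat \<Rightarrow> real) set" where
  "real_space l = {x. \<forall>k\<ge>l. x k = 0}"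

definition dot :: "nat \<Rightarrow> (nat \<Rightarrow> real) \<Rightarrow> (nat \<Rightarrow> real) \<Rightarrow> real" where
  "dot l x y = (\<Sum>k<l. x k * y k)"

definition unit_vec :: "nat \<Rightarrow> nat \<Rightarrow> real" where
  "unit_vec i = (\<lambda>k. if k = i then 1 else 0)"

definition B_roots :: "nat \<Rightarrow> (nat \<Rightarrow> real) set" where
  "B_roots l =
     {(\<lambda>k. s * unit_vec i k) | s i. s \<in> {1, -1} \<and> i < l} \<union>
     {(\<lambda>k. s * unit_vec i k + t * unit_vec j k) | s t i j.
        s \<in> {1, -1} \<and> t \<in> {1, -1} \<and> i < j \<and> j < l}"


section \<open>Complex Lie algebras\<close>

definition finite_order :: "('a \<Rightarrow> 'a) \<Rightarrow> bool" where
  "finite_order \<Psi> \<longleftrightarrow> (\<exists>n>0. \<Psi> ^^ n = id)"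

locale lie_algebra = vector_space scale
  for scale :: "complex \<Rightarrow> 'e::ab_group_add \<Rightarrow> 'e" (infixr \<open>*s\<close> 75) +
  fixes bracket :: "'e \<Rightarrow> 'e \<Rightarrow> 'e"
  assumes bracket_add_left: "bracket (x + y) z = bracket x z + bracket y z"
    and bracket_add_right: "bracket x (y + z) = bracket x y + bracket x z"
    and bracket_scale_left: "bracket (c *s x) y = c *s bracket x y"
    and bracket_scale_right: "bracket x (c *s y) = c *s bracket x y"
    and bracket_self: "bracket x x = 0"
    and jacobi: "bracket x (bracket y z) + bracket y (bracket z x) + bracket z (bracket x y) = 0"
begin

definition lie_subalgebra :: "'e set \<Rightarrow> bool" where
  "lie_subalgebra S \<longleftrightarrow> subspace S \<and> (\<forall>x\<in>S. \<forall>y\<in>S. bracket x y \<in> S)"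

definition generated_subalgebra :: "'e set \<Rightarrow> 'e set" where
  "generated_subalgebra X = \<Inter>{S. lie_subalgebra S \<and> X \<subseteq> S}"

definition centralizer :: "'e set \<Rightarrow> 'e set" where
  "centralizer X = {x. \<forall>y\<in>X. bracket x y = 0}"

definition lie_automorphism :: "('e \<Rightarrow> 'e) \<Rightarrow> bool" where
  "lie_automorphism \<Psi> \<longleftrightarrow>
     bij \<Psi> \<and>
     (\<forall>x y. \<Psi> (x + y) = \<Psi> x + \<Psi> y) \<and>
     (\<forall>c x. \<Psi> (c *s x) = c *s \<Psi> x) \<and>
     (\<forall>x y. \<Psi> (bracket x y) = bracket (\<Psi> x) (\<Psi> y))"

end


section \<open>Roots of a Lie algebra with a form and a distinguished subalgebra\<close>

locale lie_algebra_form = lie_algebra scale bracket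
  for scale :: "complex \<Rightarrow> 'e::ab_group_add \<Rightarrow> 'e" (infixr \<open>*s\<close> 75)
    and bracket :: "'e \<Rightarrow> 'e \<Rightarrow> 'e" +
  fixes form :: "'e \<Rightarrow> 'e \<Rightarrow> complex"
    and H :: "'e set"
begin

text \<open>
  A linear functional on \<open>H\<close> is represented by its extension by \<open>0\<close> outside \<open>H\<close>. Hence
  equality, sums and multiples in the dual space are those of functions.
\<close>

definition H_dual :: "('e \<Rightarrow> complex) set" where
  "H_dual = {\<alpha>. (\<forall>x\<in>H. \<forall>y\<in>H. \<alpha> (x + y) = \<alpha> x + \<alpha> y) \<and>
                (\<forall>c. \<forall>x\<in>H. \<alpha> (c *s x) = c * \<alpha> x) \<and>
                (\<forall>x. x \<notin> H \<longrightarrow> \<alpha> x = 0)}"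

definition root_space :: "('e \<Rightarrow> complex) \<Rightarrow> 'e set" where
  "root_space \<alpha> = {x. \<forall>h\<in>H. bracket h x = \<alpha> h *s x}"

definition roots :: "('e \<Rightarrow> complex) set" where
  "roots = {\<alpha> \<in> H_dual. root_space \<alpha> \<noteq> {0}}"

definition t_elem :: "('e \<Rightarrow> complex) \<Rightarrow> 'e" where
  "t_elem \<alpha> = (THE u. u \<in> H \<and> (\<forall>h\<in>H. \<alpha> h = form h u))"

definition dual_form :: "('e \<Rightarrow> complex) \<Rightarrow> ('e \<Rightarrow> complex) \<Rightarrow> complex" where
  "dual_form \<alpha> \<beta> = form (t_elem \<alpha>) (t_elem \<beta>)"

definition isotropic_roots :: "('e \<Rightarrow> complex) set" where
  "isotropic_roots = {\<alpha> \<in> roots. dual_form \<alpha> \<alpha> = 0}"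

definition nonisotropic_roots :: "('e \<Rightarrow> complex) set" where
  "nonisotropic_roots = roots - isotropic_roots"

definition core :: "'e set" where
  "core = generated_subalgebra (\<Union>\<alpha>\<in>nonisotropic_roots. root_space \<alpha>)"

subsection \<open>The type of the root system\<close>

definition real_root_span :: "('e \<Rightarrow> complex) set" where
  "real_root_span = real_span roots"

definition isotropic_span :: "('e \<Rightarrow> complex) set" where
  "isotropic_span = real_span isotropic_roots"

text \<open>The image of \<open>v\<close> in the quotient of \<^const>\<open>real_root_span\<close> by \<^const>\<open>isotropic_span\<close>.\<close>

definition bar :: "('e \<Rightarrow> complex) \<Rightarrow> ('e \<Rightarrow> complex) set" where
  "bar v = v +o isotropic_span"

text \<open>
  \<open>T\<close> is an isomorphism of root systems: a linear isomorphism from the quotient onto real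
  \<open>l\<close>-space that carries roots onto roots (with \<open>0\<close> counted as a root, as in \<^const>\<open>roots\<close>)
  and preserves the Cartan integers.
\<close>

definition type_B :: "nat \<Rightarrow> bool" where
  "type_B l \<longleftrightarrow> (\<exists>T :: ('e \<Rightarrow> complex) set \<Rightarrow> (nat \<Rightarrow> real).
     bij_betw T (bar ` real_root_span) (real_space l) \<and>
     (\<forall>v\<in>real_root_span. \<forall>w\<in>real_root_span. T (bar (v + w)) = T (bar v) + T (bar w)) \<and>
     (\<forall>r. \<forall>v\<in>real_root_span. T (bar (real_scale r v)) = (\<lambda>k. r * T (bar v) k)) \<and>
     T ` (bar ` roots) = insert 0 (B_roots l) \<and>
     (\<forall>\<alpha>\<in>nonisotropic_roots. \<forall>\<beta>\<in>roots.
        2 * dual_form \<alpha> \<beta> / dual_form \<alpha> \<alpha> =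
        complex_of_real (2 * dot l (T (bar \<alpha>)) (T (bar \<beta>)) / dot l (T (bar \<alpha>)) (T (bar \<alpha>)))))"

subsection \<open>Reflectable bases and the index\<close>

definition reflection :: "('e \<Rightarrow> complex) \<Rightarrow> ('e \<Rightarrow> complex) \<Rightarrow> ('e \<Rightarrow> complex)" where
  "reflection \<alpha> \<beta> = \<beta> - complex_scale (2 * dual_form \<alpha> \<beta> / dual_form \<alpha> \<alpha>) \<alpha>"

definition weyl_group :: "('e \<Rightarrow> complex) set \<Rightarrow> (('e \<Rightarrow> complex) \<Rightarrow> ('e \<Rightarrow> complex)) set" where
  "weyl_group P = generate (BijGroup H_dual) ((\<lambda>\<alpha>. restrict (reflection \<alpha>) H_dual) ` P)"

definition weyl_orbit :: "('e \<Rightarrow> complex) set \<Rightarrow> ('e \<Rightarrow> complex) set" where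
  "weyl_orbit P = {w \<alpha> | w \<alpha>. w \<in> weyl_group P \<and> \<alpha> \<in> P}"

definition reflectable_base :: "('e \<Rightarrow> complex) set \<Rightarrow> bool" where
  "reflectable_base P \<longleftrightarrow>
     P \<subseteq> nonisotropic_roots \<and> weyl_orbit P = nonisotropic_roots \<and>
     (\<forall>Q. Q \<subset> P \<longrightarrow> weyl_orbit Q \<noteq> nonisotropic_roots)"

text \<open>
  The infimum makes the smallest cardinality infinite if there is no finite reflectable base.
  The index lives in \<^typ>\<open>ereal\<close> so that its subtraction does not truncate.
\<close>

definition refl_number :: enat where
  "refl_number = Inf {enat (card P) | P. finite P \<and> reflectable_base P}"

definition ind :: ereal where
  "ind = ereal_of_enat refl_number - ereal (real (int_rank (int_span roots)))"

subsection \<open>Cartan automorphisms\<close>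

definition cartan_automorphism :: "('e \<Rightarrow> 'e) \<Rightarrow> bool" where
  "cartan_automorphism \<Psi> \<longleftrightarrow> lie_automorphism \<Psi> \<and> (\<forall>h\<in>H. \<Psi> h = h)"

definition eta :: "('e \<Rightarrow> 'e) \<Rightarrow> ('e \<Rightarrow> complex) \<Rightarrow> complex" where
  "eta \<Psi> \<alpha> = (THE c. \<forall>x\<in>root_space \<alpha>. \<Psi> x = c *s x)"

text \<open>The auxiliary root \<open>\<alpha>\<close> may be chosen separately for every isotropic root \<open>\<sigma>\<close>.\<close>

definition corresponding_map :: "('e \<Rightarrow> 'e) \<Rightarrow> (('e \<Rightarrow> complex) \<Rightarrow> complex) \<Rightarrow> bool" where
  "corresponding_map \<Psi> \<psi> \<longleftrightarrow>
     (\<forall>\<alpha>\<in>nonisotropic_roots. \<psi> \<alpha> = eta \<Psi> \<alpha>) \<and>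
     (\<forall>\<sigma>\<in>isotropic_roots. \<exists>\<alpha>\<in>nonisotropic_roots.
        \<alpha> + \<sigma> \<in> nonisotropic_roots \<and> \<psi> \<sigma> = eta \<Psi> (\<alpha> + \<sigma>) * eta \<Psi> (- \<alpha>))"

definition root_character :: "(('e \<Rightarrow> complex) \<Rightarrow> complex) \<Rightarrow> bool" where
  "root_character \<psi> \<longleftrightarrow>
     (\<forall>\<alpha>\<in>roots. \<psi> \<alpha> \<noteq> 0) \<and>
     (\<forall>\<alpha>\<in>roots. \<forall>\<beta>\<in>roots. \<alpha> + \<beta> \<in> roots \<longrightarrow> \<psi> (\<alpha> + \<beta>) = \<psi> \<alpha> * \<psi> \<beta>)"

end


section \<open>Extended affine Lie algebras\<close>

locale extended_affine_lie_algebra = lie_algebra_form scale bracket form H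
  for scale :: "complex \<Rightarrow> 'e::ab_group_add \<Rightarrow> 'e" (infixr \<open>*s\<close> 75)
    and bracket :: "'e \<Rightarrow> 'e \<Rightarrow> 'e"
    and form :: "'e \<Rightarrow> 'e \<Rightarrow> complex"
    and H :: "'e set" +
  assumes H_subalgebra: "lie_subalgebra H"
    and H_nontrivial: "H \<noteq> {0}"
    and H_finite_dimensional: "\<exists>B. finite B \<and> span B = H"
    and form_add: "form (x + y) z = form x z + form y z"
    and form_scale: "form (c *s x) y = c * form x y"
    and form_symmetric: "form x y = form y x"
    and form_invariant: "form (bracket x y) z = form x (bracket y z)"
    and form_nondegenerate: "(\<forall>y. form x y = 0) \<Longrightarrow> x = 0"
    and root_decomposition: "span (\<Union>\<alpha>\<in>roots. root_space \<alpha>) = UNIV"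
    and root_space_zero: "root_space 0 = H"
    and ad_locally_nilpotent:
      "\<alpha> \<in> nonisotropic_roots \<Longrightarrow> x \<in> root_space \<alpha> \<Longrightarrow> \<exists>n. (bracket x ^^ n) y = 0"
    and tame: "centralizer core \<subseteq> core"
    and root_lattice: "free_of_finite_rank (int_span roots)"
    and irreducible:
      "nonisotropic_roots = R1 \<union> R2 \<Longrightarrow> R1 \<inter> R2 = {} \<Longrightarrow> R1 \<noteq> {} \<Longrightarrow> R2 \<noteq> {} \<Longrightarrow>
       \<exists>\<alpha>\<in>R1. \<exists>\<beta>\<in>R2. dual_form \<alpha> \<beta> \<noteq> 0"

end

theory Submission
  imports Defs
begin

text \<open>
  The map \<open>\<psi>\<close> is a character because it is the restriction to \<open>R\<close> of a group homomorphism
  \<open>\<chi>\<close> from the root lattice \<open>\<langle>R\<rangle>\<close> to the nonzero complex numbers.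

  Index zero means that some reflectable base \<open>P\<close> has exactly as many elements as the rank of
  \<open>\<langle>R\<rangle>\<close>. Reflections in elements of \<open>P\<close> add integer multiples of elements of \<open>P\<close>, so
  \<open>P\<close> generates all non-isotropic roots, hence also the isotropic ones, which are differences of
  non-isotropic roots. A generating set of a lattice whose size is the rank is a basis, so there is a
  homomorphism \<open>\<chi>\<close> with \<open>\<chi>(\<alpha>) = \<eta>\<^sub>\<alpha>\<close> for all \<open>\<alpha>\<close> in \<open>P\<close>.

  It remains to see that \<open>\<chi>(\<beta>) = \<eta>\<^sub>\<beta>\<close> for every non-isotropic root \<open>\<beta>\<close>. As the base
  reaches every such root by reflections, this only requires that the eigenvalues obey
  \<open>\<eta>(w\<^sub>\<alpha> \<beta>) = \<eta>(\<beta>) \<eta>(\<alpha>)^(-n)\<close>, where \<open>n\<close> is the Cartan integer of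
  \<open>\<alpha>\<close> and \<open>\<beta>\<close> (lemma \<open>eta_reflection\<close>). This is a statement about the \<open>sl2\<close>-triple
  of \<open>\<alpha>\<close>: for \<open>n \<ge> 0\<close> the \<open>n\<close>-th power of its lowering operator \<open>f\<close> does not kill a
  root vector \<open>x\<close> of \<open>\<beta>\<close> (lemma \<open>sl2_lowering_nonzero\<close>), and \<open>f ^ n x\<close> is a root vector
  for \<open>w\<^sub>\<alpha> \<beta>\<close> that the automorphism scales by \<open>\<eta>(\<beta>) \<eta>(-\<alpha>)^n\<close>. The same lemma
  shows that root spaces of non-isotropic roots are one-dimensional, so that \<open>\<eta>\<close> makes sense.
\<close>

section \<open>Bases and ranks\<close>

text \<open>Otherwise some vector of the span of \<open>D\<close> could be added to \<open>A\<close>, which would give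
  more independent vectors than \<open>D\<close> allows by Steinitz exchange.\<close>

lemma (in vector_space) independent_in_span_imp_spanning:
  assumes "finite D" "independent A" "A \<subseteq> span D" "card D \<le> card A"
  shows "span D \<subseteq> span A"
proof
  fix v assume v: "v \<in> span D"
  show "v \<in> span A"
  proof (rule ccontr)
    assume nv: "v \<notin> span A"
    have finA: "finite A"
      using independent_span_bound[OF assms(1-3)] by simp
    have ind: "independent (insert v A)"
      using nv assms(2) by (rule independent_insertI)
    have "card (insert v A) \<le> card D"
      using independent_span_bound[OF assms(1) ind] v assms(3) by simp
    moreover have "v \<notin> A"
      using nv span_base by blast
    ultimately show False
      using finA assms(4) by simp
  qed
qed

text \<open>If one vector of \<open>A\<close> were redundant, fewer than \<open>card B\<close> vectors would span
  the independent set \<open>B\<close>.\<close>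

lemma (in vector_space) spanning_card_imp_independent:
  assumes "finite A" "independent B" "B \<subseteq> span A" "card A \<le> card B"
  shows "independent A"
proof
  assume "dependent A"
  then obtain a where a: "a \<in> A" "a \<in> span (A - {a})"
    unfolding dependent_def by blast
  have "span A = span (A - {a})"
    using span_redundant[OF a(2)] a(1) by (simp add: insert_absorb)
  hence "card B \<le> card (A - {a})"
    using independent_span_bound[of "A - {a}" B] assms by simp
  moreover have "card (A - {a}) < card A"
    using assms(1) a(1) by (rule card_Diff1_less)
  ultimately show False
    using assms(4) by simp
qed

interpretation int_module: module int_scale
  by (rule module_int_scale)

text \<open>Exchange arguments need a field of scalars. The rationals are the right one here: a set that is
  independent over the integers may well be dependent over the reals, but denominators can always
  be cleared.\<close>

definition rat_scale :: "rat \<Rightarrow> ('a \<Rightarrow> complex) \<Rightarrow> ('a \<Rightarrow> complex)" where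
  "rat_scale q f = (\<lambda>x. of_rat q * f x)"

interpretation rat_space: vector_space rat_scale
  by unfold_locales (auto simp: rat_scale_def fun_eq_iff algebra_simps of_rat_add of_rat_mult)

lemma int_scale_eq_rat_scale: "int_scale n f = rat_scale (of_int n) f"
  by (simp add: int_scale_def rat_scale_def)

lemma int_span_subset_rat_span: "int_span P \<subseteq> rat_space.span P"
proof (rule int_module.span_minimal)
  show "P \<subseteq> rat_space.span P"
    by (rule rat_space.span_superset)
  show "int_module.subspace (rat_space.span P)"
    unfolding int_module.subspace_def int_scale_eq_rat_scale
    by (simp add: rat_space.span_zero rat_space.span_add rat_space.span_scale)
qed

lemma common_denominator:
  fixes u :: "'b \<Rightarrow> rat"
  assumes "finite B"
  shows "\<exists>d::int. d > 0 \<and> (\<forall>b\<in>B. of_int d * u b \<in> \<int>)"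
  using assms
proof (induction B rule: finite_induct)
  case empty
  show ?case by (intro exI[of _ 1]) simp
next
  case (insert b B)
  then obtain d :: int where d: "d > 0" "\<forall>b\<in>B. of_int d * u b \<in> \<int>"
    by blast
  obtain p q where pq: "quotient_of (u b) = (p, q)"
    by force
  have q: "q > 0" and u: "u b = of_int p / of_int q"
    using quotient_of_denom_pos[OF pq] quotient_of_div[OF pq] by simp_all
  have "of_int (q * d) * u c \<in> \<int>" if "c \<in> insert b B" for c
  proof (cases "c = b")
    case True
    have "of_int (q * d) * u b = of_int (d * p)"
      using q by (simp add: u)
    thus ?thesis using True by (metis Ints_of_int)
  next
    case False
    hence "of_int d * u c \<in> \<int>" using d(2) that by simp
    hence "of_int q * (of_int d * u c) \<in> \<int>" by simp
    thus ?thesis by (simp add: mult.assoc)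
  qed
  thus ?case using q d(1) by (intro exI[of _ "q * d"]) simp
qed

lemma int_independent_imp_rat_independent:
  assumes "finite B" "int_module.independent B"
  shows "rat_space.independent B"
proof
  assume "rat_space.dependent B"
  then obtain u v where u: "v \<in> B" "u v \<noteq> 0" "(\<Sum>v\<in>B. rat_scale (u v) v) = 0"
    unfolding rat_space.dependent_finite[OF assms(1)] by blast
  obtain d :: int where d: "d > 0" "\<forall>b\<in>B. of_int d * u b \<in> \<int>"
    using common_denominator[OF assms(1)] by blast
  define n where "n b = \<lfloor>of_int d * u b\<rfloor>" for b
  have n: "rat_of_int (n b) = of_int d * u b" if "b \<in> B" for b
    using d(2) that by (auto simp: n_def elim!: Ints_cases)
  have "(\<Sum>b\<in>B. int_scale (n b) b) = (\<Sum>b\<in>B. rat_scale (of_int d) (rat_scale (u b) b))"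
    by (rule sum.cong) (simp_all add: int_scale_eq_rat_scale n)
  also have "\<dots> = rat_scale (of_int d) (\<Sum>v\<in>B. rat_scale (u v) v)"
    by (rule rat_space.scale_sum_right[symmetric])
  finally have "(\<Sum>b\<in>B. int_scale (n b) b) = 0"
    by (simp add: u(3))
  moreover have "n v \<noteq> 0"
    using n[OF u(1)] u(2) d(1) by auto
  ultimately have "int_module.dependent B"
    unfolding int_module.dependent_finite[OF assms(1)] using u(1) by blast
  thus False using assms(2) by simp
qed

lemma rat_independent_imp_int_independent:
  assumes "finite P" "rat_space.independent P"
  shows "int_module.independent P"
proof
  assume "int_module.dependent P"
  then obtain u v where u: "v \<in> P" "u v \<noteq> 0" "(\<Sum>v\<in>P. int_scale (u v) v) = 0"
    unfolding int_module.dependent_finite[OF assms(1)] by blast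
  hence "rat_space.dependent P"
    unfolding rat_space.dependent_finite[OF assms(1)] int_scale_eq_rat_scale
    by (intro exI[of _ "\<lambda>v. of_int (u v)"]) auto
  thus False using assms(2) by simp
qed

text \<open>A generating set whose size is the rank of a lattice is a basis of it. The rank is the size of
  some chosen basis \<open>B\<close>, which stays independent over the rationals, so counting rational
  dimensions leaves no room for a relation in \<open>P\<close>.\<close>

lemma int_generating_card_rank_imp_independent:
  assumes "free_of_finite_rank G" "finite P" "int_span P = G" "card P = int_rank G"
  shows "int_module.independent P"
proof -
  define B where "B = (SOME B. finite B \<and> int_basis G B)"
  have "finite B \<and> int_basis G B"
    unfolding B_def by (rule someI_ex) (use assms(1) in \<open>simp add: free_of_finite_rank_def\<close>)
  hence B: "finite B" "int_module.independent B" "int_span B = G"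
    by (simp_all add: int_basis_def)
  have "B \<subseteq> rat_space.span P"
    using int_module.span_superset[of B] int_span_subset_rat_span[of P] B(3) assms(3) by simp
  moreover have "card P \<le> card B"
    using assms(4) by (simp add: int_rank_def B_def)
  ultimately have "rat_space.independent P"
    using rat_space.spanning_card_imp_independent[OF assms(2)]
      int_independent_imp_rat_independent[OF B(1,2)] by blast
  thus ?thesis
    by (rule rat_independent_imp_int_independent[OF assms(2)])
qed

lemma prod_power_int: "(\<Prod>a\<in>A. f a powi n) = (\<Prod>a\<in>A. (f a :: 'b::field)) powi n"
  by (induction A rule: infinite_finite_induct) (simp_all add: power_int_mult_distrib)

text \<open>The values on a basis may be prescribed freely: the extension is the product of the prescribed
  values raised to the coordinates.\<close>

lemma int_basis_hom_extension:
  fixes \<eta> :: "('a \<Rightarrow> complex) \<Rightarrow> complex"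
  assumes "finite P" "int_module.independent P" "\<And>p. p \<in> P \<Longrightarrow> \<eta> p \<noteq> 0"
  shows "\<exists>\<chi>. (\<forall>g. \<chi> g \<noteq> 0) \<and> (\<forall>p\<in>P. \<chi> p = \<eta> p) \<and>
    (\<forall>g\<in>int_span P. \<forall>h\<in>int_span P. \<chi> (g + h) = \<chi> g * \<chi> h) \<and>
    (\<forall>n. \<forall>g\<in>int_span P. \<chi> (int_scale n g) = \<chi> g powi n)"
proof (intro exI conjI allI ballI)
  let ?r = "int_module.representation P"
  let ?\<chi> = "\<lambda>g. \<Prod>p\<in>P. \<eta> p powi ?r g p"
  show "?\<chi> g \<noteq> 0" for g
    using assms(1,3) by simp
  show "?\<chi> p = \<eta> p" if "p \<in> P" for p
  proof -
    have "?\<chi> p = (\<Prod>q\<in>P. if q = p then \<eta> q else 1)"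
      by (rule prod.cong) (simp_all add: int_module.representation_basis[OF assms(2) that])
    also have "\<dots> = \<eta> p"
      using assms(1) that by simp
    finally show ?thesis .
  qed
  show "?\<chi> (g + h) = ?\<chi> g * ?\<chi> h" if "g \<in> int_span P" "h \<in> int_span P" for g h
    using assms(3) by (simp add: int_module.representation_add[OF assms(2) that(2,1)]
        power_int_add prod.distrib cong: prod.cong)
  show "?\<chi> (int_scale n g) = ?\<chi> g powi n" if "g \<in> int_span P" for n g
  proof -
    have "?\<chi> (int_scale n g) = (\<Prod>p\<in>P. (\<eta> p powi ?r g p) powi n)"
      by (simp add: int_module.representation_scale[OF assms(2) that] mult.commute[of n]
          power_int_mult)
    also have "\<dots> = ?\<chi> g powi n"
      by (rule prod_power_int)
    finally show ?thesis .
  qed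
qed

section \<open>Triples spanning a copy of sl2\<close>

context lie_algebra
begin

lemma bracket_zero_left [simp]: "bracket 0 x = 0"
  using bracket_scale_left[of 0 0 x] by simp

lemma bracket_zero_right [simp]: "bracket x 0 = 0"
  using bracket_scale_right[of x 0 0] by simp

lemma funpow_bracket_zero [simp]: "(bracket x ^^ n) 0 = 0"
  by (induction n) simp_all

lemma bracket_minus_left: "bracket (- x) y = - bracket x y"
  using bracket_scale_left[of "- 1" x y] by simp

lemma bracket_minus_right: "bracket x (- y) = - bracket x y"
  using bracket_scale_right[of x "- 1" y] by simp

lemma bracket_antisym: "bracket x y = - bracket y x"
proof -
  have "0 = bracket (x + y) (x + y)"
    by (simp add: bracket_self)
  also have "\<dots> = bracket x y + bracket y x"
    by (simp add: bracket_add_left bracket_add_right bracket_self[of x] bracket_self[of y])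
  finally have "bracket x y + bracket y x = 0"
    by (rule sym)
  thus ?thesis
    by (rule eq_neg_iff_add_eq_0[THEN iffD2])
qed

lemma ad_derivation: "bracket x (bracket y z) = bracket (bracket x y) z + bracket y (bracket x z)"
proof -
  have "bracket x (bracket y z) - bracket y (bracket x z) - bracket (bracket x y) z = 0"
    using jacobi[of x y z] bracket_antisym[of z x] bracket_antisym[of z "bracket x y"]
    by (simp add: bracket_minus_right)
  thus ?thesis
    by (simp add: algebra_simps)
qed

definition sl2_triple :: "'e \<Rightarrow> 'e \<Rightarrow> 'e \<Rightarrow> bool" where
  "sl2_triple e h f \<longleftrightarrow> bracket e f = h \<and> bracket h e = 2 *s e \<and> bracket h f = - 2 *s f"

lemma sl2_lowering_weight:
  assumes "sl2_triple e h f" "bracket h x = c *s x"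
  shows "bracket h ((bracket f ^^ j) x) = (c - 2 * of_nat j) *s (bracket f ^^ j) x"
proof (induction j)
  case (Suc j)
  have "bracket h ((bracket f ^^ Suc j) x) =
      - 2 *s (bracket f ^^ Suc j) x + (c - 2 * of_nat j) *s (bracket f ^^ Suc j) x"
    using assms(1) Suc by (simp add: ad_derivation[of h] sl2_triple_def
        bracket_scale_left bracket_scale_right bracket_minus_left)
  also have "\<dots> = (- 2 + (c - 2 * of_nat j)) *s (bracket f ^^ Suc j) x"
    by (rule scale_left_distrib[symmetric])
  also have "- 2 + (c - 2 * of_nat j) = c - 2 * of_nat (Suc j)"
    by simp
  finally show ?case .
qed (simp add: assms(2))

lemma sl2_raising_weight:
  assumes "sl2_triple e h f" "bracket h x = c *s x"
  shows "bracket h ((bracket e ^^ j) x) = (c + 2 * of_nat j) *s (bracket e ^^ j) x"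
proof (induction j)
  case (Suc j)
  have "bracket h ((bracket e ^^ Suc j) x) =
      2 *s (bracket e ^^ Suc j) x + (c + 2 * of_nat j) *s (bracket e ^^ Suc j) x"
    using assms(1) Suc by (simp add: ad_derivation[of h] sl2_triple_def
        bracket_scale_left bracket_scale_right bracket_minus_left)
  also have "\<dots> = (2 + (c + 2 * of_nat j)) *s (bracket e ^^ Suc j) x"
    by (rule scale_left_distrib[symmetric])
  also have "2 + (c + 2 * of_nat j) = c + 2 * of_nat (Suc j)"
    by simp
  finally show ?case .
qed (simp add: assms(2))

text \<open>This is the relation between \<open>e\<close> and powers of \<open>f\<close> in the enveloping algebra of
  \<open>sl2\<close>. Nonvanishing under lowering and integrality of weights both come from its coefficients.\<close>

lemma sl2_commutation:
  assumes "sl2_triple e h f" "bracket h x = c *s x"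
  shows "bracket e ((bracket f ^^ Suc j) x) =
    (bracket f ^^ Suc j) (bracket e x) + (of_nat (Suc j) * (c - of_nat j)) *s (bracket f ^^ j) x"
proof (induction j)
  case 0
  show ?case
    using assms by (simp add: ad_derivation[of e f] sl2_triple_def)
next
  case (Suc j)
  have "bracket e ((bracket f ^^ Suc (Suc j)) x) =
      bracket h ((bracket f ^^ Suc j) x) + bracket f (bracket e ((bracket f ^^ Suc j) x))"
    using assms(1) by (simp add: ad_derivation[of e f] sl2_triple_def)
  also have "\<dots> = (c - 2 * of_nat (Suc j)) *s (bracket f ^^ Suc j) x +
      ((bracket f ^^ Suc (Suc j)) (bracket e x) + (of_nat (Suc j) * (c - of_nat j)) *s (bracket f ^^ Suc j) x)"
    unfolding sl2_lowering_weight[OF assms] Suc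
    by (simp add: bracket_add_right bracket_scale_right)
  also have "\<dots> = (bracket f ^^ Suc (Suc j)) (bracket e x) +
      ((c - 2 * of_nat (Suc j)) + of_nat (Suc j) * (c - of_nat j)) *s (bracket f ^^ Suc j) x"
    by (simp only: scale_left_distrib add_ac)
  also have "(c - 2 * of_nat (Suc j)) + of_nat (Suc j) * (c - of_nat j) =
      of_nat (Suc (Suc j)) * (c - of_nat (Suc j))"
    by (simp add: algebra_simps)
  finally show ?case .
qed

text \<open>In a finite-dimensional module this is the bijectivity of \<open>f ^ n\<close> from weight \<open>n\<close> to
  weight \<open>-n\<close>. Here only \<open>e\<close> is known to be nilpotent, and only on \<open>x\<close>. The proof is by
  induction on the order of nilpotency: for a highest weight vector the coefficients in the
  commutation relation do not vanish before the \<open>n\<close>-th step, and otherwise the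
  claim for \<open>e x\<close>, of weight \<open>n + 2\<close>, is pulled back to \<open>x\<close>.\<close>

lemma sl2_lowering_nonzero:
  assumes "sl2_triple e h f"
  shows "bracket h x = of_nat n *s x \<Longrightarrow> x \<noteq> 0 \<Longrightarrow> (bracket e ^^ k) x = 0 \<Longrightarrow> (bracket f ^^ n) x \<noteq> 0"
proof (induction k arbitrary: n x)
  case (Suc k)
  show ?case
  proof (cases "bracket e x = 0")
    case True
    have "j \<le> n \<Longrightarrow> (bracket f ^^ j) x \<noteq> 0" for j
    proof (induction j)
      case (Suc j)
      have "bracket e ((bracket f ^^ Suc j) x) = (of_nat (Suc j) * (of_nat n - of_nat j)) *s (bracket f ^^ j) x"
        using sl2_commutation[OF assms \<open>bracket h x = of_nat n *s x\<close>, of j] True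
        by (simp only: funpow_bracket_zero add_0_left)
      moreover have "of_nat (Suc j) * (of_nat n - of_nat j) \<noteq> (0::complex)"
        using Suc.prems by (metis Suc_le_lessD eq_iff_diff_eq_0 mult_eq_0_iff nat.distinct(1)
            of_nat_eq_0_iff of_nat_eq_iff less_irrefl)
      ultimately have "bracket e ((bracket f ^^ Suc j) x) \<noteq> 0"
        using Suc by simp
      thus ?case by force
    qed (use Suc.prems in simp)
    thus ?thesis by simp
  next
    case False
    have "bracket h (bracket e x) = of_nat (n + 2) *s bracket e x"
      using sl2_raising_weight[OF assms Suc.prems(1), of 1] by (simp add: add.commute)
    moreover have "(bracket e ^^ k) (bracket e x) = 0"
      using Suc.prems(3) by (simp add: funpow_swap1)
    ultimately have nz: "(bracket f ^^ (n + 2)) (bracket e x) \<noteq> 0"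
      using Suc.IH False by blast
    show ?thesis
    proof
      assume "(bracket f ^^ n) x = 0"
      \<comment> \<open>In the commutation relation for \<open>j = n + 1\<close>, the left-hand side and the last term arise
        from \<open>f ^ n x\<close> by applying further operators, so \<open>f ^ (n + 2) (e x)\<close> would vanish as well.\<close>
      thus False
        using nz sl2_commutation[OF assms Suc.prems(1), of "Suc n"] by simp
    qed
  qed
qed simp

lemma last_nonzero_iterate:
  fixes g :: "'e \<Rightarrow> 'e"
  assumes "(g ^^ k) x = 0" "x \<noteq> 0"
  shows "\<exists>i. (g ^^ i) x \<noteq> 0 \<and> g ((g ^^ i) x) = 0"
  using assms(1)
proof (induction k)
  case (Suc k)
  thus ?case by (cases "(g ^^ k) x = 0") auto
qed (use assms(2) in simp)

text \<open>Raise \<open>x\<close> as far as possible to a highest weight vector \<open>y\<close>. Applying \<open>e\<close> to the first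
  vanishing \<open>f ^ (j + 1) y\<close> shows that the weight of \<open>y\<close> is \<open>j\<close>, and the weight of \<open>x\<close>
  differs from it by an even integer.\<close>

lemma sl2_weight_integral:
  assumes "sl2_triple e h f" "bracket h x = c *s x" "x \<noteq> 0"
    and nilp_e: "(bracket e ^^ k) x = 0"
    and nilp_f: "\<And>y. \<exists>m. (bracket f ^^ m) y = 0"
  shows "\<exists>n::int. c = of_int n"
proof -
  obtain i where i: "(bracket e ^^ i) x \<noteq> 0" "bracket e ((bracket e ^^ i) x) = 0"
    using last_nonzero_iterate[OF nilp_e assms(3)] by blast
  define y where "y = (bracket e ^^ i) x"
  define d where "d = c + 2 * of_nat i"
  have hy: "bracket h y = d *s y"
    unfolding y_def d_def by (rule sl2_raising_weight[OF assms(1,2)])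
  have ey: "bracket e y = 0" and y: "y \<noteq> 0"
    using i by (simp_all add: y_def)
  obtain m where "(bracket f ^^ m) y = 0"
    using nilp_f by blast
  then obtain j where j: "(bracket f ^^ j) y \<noteq> 0" "bracket f ((bracket f ^^ j) y) = 0"
    using last_nonzero_iterate[OF _ y] by blast
  have "(bracket f ^^ Suc j) 0 = 0"
    by (rule funpow_bracket_zero)
  hence "(of_nat (Suc j) * (d - of_nat j)) *s (bracket f ^^ j) y = 0"
    using sl2_commutation[OF assms(1) hy, of j] j(2) by (simp add: ey)
  hence "of_nat (Suc j) * (d - of_nat j) = 0"
    using j(1) scale_eq_0_iff by metis
  hence "d = of_nat j"
    by (simp del: of_nat_Suc)
  hence "c = of_int (int j - 2 * int i)"
    by (simp add: d_def algebra_simps)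
  thus ?thesis ..
qed

end

section \<open>Root spaces and the form\<close>

context extended_affine_lie_algebra
begin

lemma form_add_right: "form x (y + z) = form x y + form x z"
  using form_add form_symmetric by metis

lemma form_scale_right: "form x (c *s y) = c * form x y"
  using form_scale form_symmetric by metis

lemma form_zero_right [simp]: "form x 0 = 0"
  using form_scale_right[of x 0 0] by simp

lemma form_minus_right: "form x (- y) = - form x y"
  using form_scale_right[of x "- 1" y] by simp

lemma form_diff_right: "form x (y - z) = form x y - form x z"
  using form_add_right[of x y "- z"] by (simp add: form_minus_right)

lemma subspace_H: "subspace H"
  using H_subalgebra by (simp add: lie_subalgebra_def)

lemmas H_closed = subspace_0[OF subspace_H] subspace_add[OF subspace_H]
  subspace_scale[OF subspace_H] subspace_diff[OF subspace_H] subspace_neg[OF subspace_H]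

lemma H_dualD:
  assumes "\<alpha> \<in> H_dual"
  shows "\<And>x y. x \<in> H \<Longrightarrow> y \<in> H \<Longrightarrow> \<alpha> (x + y) = \<alpha> x + \<alpha> y"
    "\<And>c x. x \<in> H \<Longrightarrow> \<alpha> (c *s x) = c * \<alpha> x"
    "\<And>x. x \<notin> H \<Longrightarrow> \<alpha> x = 0"
  using assms by (auto simp: H_dual_def)

lemma H_dual_closed:
  assumes "\<alpha> \<in> H_dual"
  shows "\<beta> \<in> H_dual \<Longrightarrow> \<alpha> + \<beta> \<in> H_dual"
    and "\<beta> \<in> H_dual \<Longrightarrow> \<alpha> - \<beta> \<in> H_dual"
    and "- \<alpha> \<in> H_dual"
    and "complex_scale c \<alpha> \<in> H_dual"
  using assms by (auto simp: H_dual_def complex_scale_def algebra_simps H_closed)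

lemma zero_H_dual [simp]: "0 \<in> H_dual"
  by (simp add: H_dual_def)

lemma root_spaceI: "(\<And>h. h \<in> H \<Longrightarrow> bracket h x = \<alpha> h *s x) \<Longrightarrow> x \<in> root_space \<alpha>"
  by (simp add: root_space_def)

lemma root_spaceD: "x \<in> root_space \<alpha> \<Longrightarrow> h \<in> H \<Longrightarrow> bracket h x = \<alpha> h *s x"
  by (simp add: root_space_def)

lemma subspace_root_space: "subspace (root_space \<alpha>)"
  unfolding subspace_def root_space_def
  by (auto simp: bracket_add_right bracket_scale_right scale_right_distrib mult.commute)

lemma bracket_root_space:
  assumes "x \<in> root_space \<alpha>" "y \<in> root_space \<beta>"
  shows "bracket x y \<in> root_space (\<alpha> + \<beta>)"
proof (rule root_spaceI)
  fix h assume h: "h \<in> H"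
  show "bracket h (bracket x y) = (\<alpha> + \<beta>) h *s bracket x y"
    using assms[THEN root_spaceD, OF h]
    by (simp add: ad_derivation[of h] bracket_scale_left bracket_scale_right scale_left_distrib)
qed

lemma funpow_bracket_root_space:
  assumes "f \<in> root_space \<alpha>" "x \<in> root_space \<beta>"
  shows "(bracket f ^^ n) x \<in> root_space (\<beta> + complex_scale (of_nat n) \<alpha>)"
proof (induction n)
  case 0
  have "complex_scale 0 \<alpha> = 0"
    by (simp add: complex_scale_def fun_eq_iff)
  thus ?case
    using assms(2) by simp
next
  case (Suc n)
  have eq: "\<alpha> + (\<beta> + complex_scale (of_nat n) \<alpha>) = \<beta> + complex_scale (of_nat (Suc n)) \<alpha>"
    by (rule ext) (simp add: complex_scale_def distrib_right add.left_commute)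
  show ?case
    using bracket_root_space[OF assms(1) Suc] unfolding eq by (simp only: funpow.simps o_apply)
qed

lemma rootsI:
  assumes "\<alpha> \<in> H_dual" "x \<in> root_space \<alpha>" "x \<noteq> 0"
  shows "\<alpha> \<in> roots"
  using assms by (auto simp: roots_def)

lemma root_vector_exists:
  assumes "\<alpha> \<in> roots"
  obtains x where "x \<in> root_space \<alpha>" "x \<noteq> 0"
  using assms subspace_0[OF subspace_root_space, of \<alpha>] by (auto simp: roots_def)

lemma roots_subset_H_dual: "\<alpha> \<in> roots \<Longrightarrow> \<alpha> \<in> H_dual"
  by (simp add: roots_def)

lemma nonisotropic_roots_iff: "\<alpha> \<in> nonisotropic_roots \<longleftrightarrow> \<alpha> \<in> roots \<and> dual_form \<alpha> \<alpha> \<noteq> 0"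
  by (auto simp: nonisotropic_roots_def isotropic_roots_def)

lemma root_spaces_orthogonal:
  assumes "x \<in> root_space \<alpha>" "y \<in> root_space \<beta>" "form x y \<noteq> 0" "h \<in> H"
  shows "\<alpha> h + \<beta> h = 0"
proof -
  have "\<alpha> h * form x y = form (bracket h x) y"
    by (simp add: root_spaceD[OF assms(1,4)] form_scale)
  also have "\<dots> = - form (bracket x h) y"
    using bracket_antisym[of h x] form_symmetric form_minus_right by metis
  also have "\<dots> = - form x (bracket h y)"
    by (simp add: form_invariant)
  also have "\<dots> = - (\<beta> h * form x y)"
    by (simp add: root_spaceD[OF assms(2,4)] form_scale_right)
  finally have "(\<alpha> h + \<beta> h) * form x y = 0"
    by (simp add: algebra_simps)
  thus ?thesis
    using assms(3) by simp
qed

text \<open>Root spaces pair to zero unless their roots are opposite, while the form is non-degenerate and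
  the root spaces span; so a nonzero \<open>x\<close> must pair with something in the opposite root space.
  The case \<open>\<alpha> = 0\<close> says that the form is non-degenerate on \<open>H\<close>.\<close>

lemma root_space_pairing_nondegenerate:
  assumes "\<alpha> \<in> H_dual" "x \<in> root_space \<alpha>" "x \<noteq> 0"
  obtains y where "y \<in> root_space (- \<alpha>)" "form x y \<noteq> 0"
proof -
  have "\<exists>\<beta>\<in>roots. \<exists>y\<in>root_space \<beta>. form x y \<noteq> 0"
  proof (rule ccontr)
    assume "\<not> ?thesis"
    hence "(\<Union>\<beta>\<in>roots. root_space \<beta>) \<subseteq> {y. form x y = 0}"
      by auto
    moreover have "subspace {y. form x y = 0}"
      by (simp add: subspace_def form_add_right form_scale_right)
    ultimately have "UNIV \<subseteq> {y. form x y = 0}"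
      using span_minimal root_decomposition by metis
    thus False
      using form_nondegenerate[of x] assms(3) by auto
  qed
  then obtain \<beta> y where y: "\<beta> \<in> roots" "y \<in> root_space \<beta>" "form x y \<noteq> 0"
    by blast
  have "\<beta> h = - \<alpha> h" for h
  proof (cases "h \<in> H")
    case True
    thus ?thesis
      using root_spaces_orthogonal[OF assms(2) y(2,3)] by (simp add: eq_neg_iff_add_eq_0 add.commute)
  next
    case False
    thus ?thesis
      by (simp add: H_dualD(3)[OF assms(1)] H_dualD(3)[OF roots_subset_H_dual[OF y(1)]])
  qed
  hence "\<beta> = - \<alpha>"
    by (simp add: fun_eq_iff)
  thus ?thesis
    using that y by blast
qed

lemma form_nondegenerate_on_H:
  assumes "x \<in> H" "\<And>y. y \<in> H \<Longrightarrow> form y x = 0"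
  shows "x = 0"
proof (rule ccontr)
  assume "x \<noteq> 0"
  then obtain y where "y \<in> root_space (- 0)" "form x y \<noteq> 0"
    using root_space_pairing_nondegenerate[of 0 x] assms(1) root_space_zero by auto
  thus False
    using assms(2)[of y] root_space_zero form_symmetric by simp
qed

text \<open>This is the Riesz representation for the non-degenerate form on the finite-dimensional space
  \<open>H\<close>. It makes \<^const>\<open>t_elem\<close> meaningful on all of the dual space, and so makes the
  reflections involutions of the whole dual space.\<close>

lemma H_dual_representable:
  assumes "\<alpha> \<in> H_dual"
  shows "\<exists>u\<in>H. \<forall>h\<in>H. \<alpha> h = form h u"
proof -
  obtain B0 where B0: "finite B0" "span B0 = H"
    using H_finite_dimensional by blast
  obtain B where B: "B \<subseteq> B0" "independent B" "B0 \<subseteq> span B"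
    using maximal_independent_subset[of B0] by blast
  have finB: "finite B"
    using B(1) B0(1) by (rule finite_subset)
  have spanB: "span B = H"
    using B(1,3) B0(2) span_mono[of B B0] span_minimal[of B0 "span B"] by auto
  have BH: "B \<subseteq> H"
    using span_superset[of B] spanB by simp
  interpret V: vector_space "complex_scale :: complex \<Rightarrow> ('e \<Rightarrow> complex) \<Rightarrow> _"
    by unfold_locales (auto simp: complex_scale_def fun_eq_iff algebra_simps)
  \<comment> \<open>Non-degeneracy makes this map injective on \<open>H\<close>. Its target, the functions supported on
    \<open>B\<close>, is spanned by \<open>card B\<close> indicator functions, so it is surjective too.\<close>
  define \<Phi> where "\<Phi> u = (\<lambda>b. if b \<in> B then form b u else 0)" for u
  define \<delta> :: "'e \<Rightarrow> 'e \<Rightarrow> complex" where "\<delta> b = (\<lambda>x. if x = b then 1 else 0)" for b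
  interpret \<Phi>: Vector_Spaces.linear scale complex_scale \<Phi>
    by unfold_locales (auto simp: \<Phi>_def complex_scale_def fun_eq_iff form_add_right form_scale_right)
  have agree: "\<beta> h = \<gamma> h" if "\<And>b. b \<in> B \<Longrightarrow> \<beta> b = \<gamma> b" "h \<in> H"
    and lin: "\<And>x y. x \<in> H \<Longrightarrow> y \<in> H \<Longrightarrow> \<beta> (x + y) = \<beta> x + \<beta> y"
      "\<And>c x. x \<in> H \<Longrightarrow> \<beta> (c *s x) = c * \<beta> x"
      "\<And>x y. x \<in> H \<Longrightarrow> y \<in> H \<Longrightarrow> \<gamma> (x + y) = \<gamma> x + \<gamma> y"
      "\<And>c x. x \<in> H \<Longrightarrow> \<gamma> (c *s x) = c * \<gamma> x"
    for \<beta> \<gamma> :: "'e \<Rightarrow> complex" and h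
  proof -
    have "subspace {h \<in> H. \<beta> h = \<gamma> h}"
      using lin lin(2,4)[of 0 0] by (auto simp: subspace_def H_closed)
    moreover have "B \<subseteq> {h \<in> H. \<beta> h = \<gamma> h}"
      using that(1) BH by auto
    ultimately have "H \<subseteq> {h \<in> H. \<beta> h = \<gamma> h}"
      using span_minimal spanB by metis
    thus ?thesis using that(2) by blast
  qed
  have inj: "inj_on \<Phi> H"
  proof (rule inj_onI)
    fix u v assume uv: "u \<in> H" "v \<in> H" "\<Phi> u = \<Phi> v"
    have "form b (u - v) = 0" if "b \<in> B" for b
      using fun_cong[OF uv(3), of b] that by (simp add: \<Phi>_def form_diff_right)
    hence "form h (u - v) = 0" if "h \<in> H" for h
      using agree[of "\<lambda>h. form h (u - v)" "\<lambda>_. 0" h] that by (simp add: form_add form_scale)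
    hence "u - v = 0"
      using form_nondegenerate_on_H[of "u - v"] subspace_diff[OF subspace_H uv(1,2)] by blast
    thus "u = v" by simp
  qed
  have supported: "g \<in> V.span (\<delta> ` B)" if "\<And>b. b \<notin> B \<Longrightarrow> g b = 0" for g
  proof -
    have "(\<Sum>b\<in>B. complex_scale (g b) (\<delta> b)) \<in> V.span (\<delta> ` B)"
      by (intro V.span_sum V.span_scale V.span_base) auto
    also have "(\<Sum>b\<in>B. complex_scale (g b) (\<delta> b)) = g"
    proof
      fix x
      have "(\<Sum>b\<in>B. complex_scale (g b) (\<delta> b)) x = (\<Sum>b\<in>B. if b = x then g b else 0)"
        by (induction B rule: infinite_finite_induct) (auto simp: complex_scale_def \<delta>_def)
      thus "(\<Sum>b\<in>B. complex_scale (g b) (\<delta> b)) x = g x"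
        using finB that[of x] by simp
    qed
    finally show ?thesis .
  qed
  have "V.span (\<delta> ` B) \<subseteq> V.span (\<Phi> ` B)"
  proof (rule V.independent_in_span_imp_spanning)
    show "V.independent (\<Phi> ` B)"
      using B(2) inj spanB by (intro \<Phi>.independent_injective_image) simp_all
    show "\<Phi> ` B \<subseteq> V.span (\<delta> ` B)"
      by (auto intro!: supported simp: \<Phi>_def)
    have "card (\<Phi> ` B) = card B"
      using inj_on_subset[OF inj BH] by (rule card_image)
    thus "card (\<delta> ` B) \<le> card (\<Phi> ` B)"
      using card_image_le[OF finB, of \<delta>] by simp
  qed (use finB in simp)
  moreover have "(\<lambda>b. if b \<in> B then \<alpha> b else 0) \<in> V.span (\<delta> ` B)"
    by (rule supported) simp
  ultimately have "(\<lambda>b. if b \<in> B then \<alpha> b else 0) \<in> \<Phi> ` H"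
    using \<Phi>.span_image[of B] spanB by blast
  then obtain u where u: "u \<in> H" "(\<lambda>b. if b \<in> B then \<alpha> b else 0) = \<Phi> u"
    by blast
  have "\<alpha> b = form b u" if "b \<in> B" for b
    using fun_cong[OF u(2), of b] that by (simp add: \<Phi>_def)
  hence "\<alpha> h = form h u" if "h \<in> H" for h
    using agree[of \<alpha> "\<lambda>h. form h u" h] that H_dualD[OF assms] by (simp add: form_add form_scale)
  thus ?thesis
    using u(1) by blast
qed

lemma t_elem:
  assumes "\<alpha> \<in> H_dual"
  shows "t_elem \<alpha> \<in> H" and "h \<in> H \<Longrightarrow> form h (t_elem \<alpha>) = \<alpha> h"
proof -
  have "\<exists>!u. u \<in> H \<and> (\<forall>h\<in>H. \<alpha> h = form h u)"
  proof (rule ex_ex1I)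
    show "\<exists>u. u \<in> H \<and> (\<forall>h\<in>H. \<alpha> h = form h u)"
      using H_dual_representable[OF assms] by blast
    fix u v assume u: "u \<in> H \<and> (\<forall>h\<in>H. \<alpha> h = form h u)" and v: "v \<in> H \<and> (\<forall>h\<in>H. \<alpha> h = form h v)"
    have "form h (u - v) = 0" if "h \<in> H" for h
      using u v that by (simp add: form_diff_right)
    hence "u - v = 0"
      using form_nondegenerate_on_H[of "u - v"] subspace_diff[OF subspace_H] u v by blast
    thus "u = v" by simp
  qed
  from theI'[OF this] show "t_elem \<alpha> \<in> H" and "h \<in> H \<Longrightarrow> form h (t_elem \<alpha>) = \<alpha> h"
    unfolding t_elem_def by auto
qed

lemma dual_form_eq:
  assumes "\<alpha> \<in> H_dual" "\<beta> \<in> H_dual"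
  shows "dual_form \<alpha> \<beta> = \<beta> (t_elem \<alpha>)"
  unfolding dual_form_def using t_elem assms by blast

lemma dual_form_symmetric: "dual_form \<alpha> \<beta> = dual_form \<beta> \<alpha>"
  by (simp add: dual_form_def form_symmetric)

lemma dual_form_reflected:
  assumes "\<alpha> \<in> H_dual" "\<beta> \<in> H_dual" "\<gamma> \<in> H_dual"
  shows "dual_form \<gamma> (\<beta> - complex_scale c \<alpha>) = dual_form \<gamma> \<beta> - c * dual_form \<gamma> \<alpha>"
  using assms by (simp add: dual_form_eq H_dual_closed) (simp add: complex_scale_def)

lemma dual_form_minus:
  assumes "\<alpha> \<in> H_dual" "\<beta> \<in> H_dual"
  shows "dual_form (- \<alpha>) \<beta> = - dual_form \<alpha> \<beta>"
  using assms by (simp add: dual_form_symmetric[of _ \<beta>] dual_form_eq H_dual_closed)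

text \<open>Both sides lie in \<open>H\<close> and, by invariance of the form, have the same pairing with every
  element of \<open>H\<close>.\<close>

lemma bracket_opposite_root_vectors:
  assumes "\<alpha> \<in> H_dual" "e \<in> root_space \<alpha>" "f \<in> root_space (- \<alpha>)"
  shows "bracket e f = form e f *s t_elem \<alpha>"
proof -
  have ef: "bracket e f \<in> H"
    using bracket_root_space[OF assms(2,3)] root_space_zero by simp
  have "form h (bracket e f - form e f *s t_elem \<alpha>) = 0" if h: "h \<in> H" for h
  proof -
    have "form h (bracket e f) = form (bracket h e) f"
      by (simp add: form_invariant)
    thus ?thesis
      by (simp add: root_spaceD[OF assms(2) h] form_scale form_diff_right form_scale_right
          t_elem(2)[OF assms(1) h])
  qed
  hence "bracket e f - form e f *s t_elem \<alpha> = 0"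
    by (intro form_nondegenerate_on_H H_closed ef t_elem(1)[OF assms(1)])
  thus ?thesis by simp
qed

lemma uminus_nonisotropic:
  assumes "\<alpha> \<in> nonisotropic_roots"
  shows "- \<alpha> \<in> nonisotropic_roots"
proof -
  have \<alpha>: "\<alpha> \<in> roots" "dual_form \<alpha> \<alpha> \<noteq> 0" "\<alpha> \<in> H_dual"
    using assms roots_subset_H_dual by (auto simp: nonisotropic_roots_iff)
  obtain x where x: "x \<in> root_space \<alpha>" "x \<noteq> 0"
    using \<alpha>(1) by (rule root_vector_exists)
  then obtain y where y: "y \<in> root_space (- \<alpha>)" "form x y \<noteq> 0"
    using root_space_pairing_nondegenerate \<alpha>(3) by blast
  have "- \<alpha> \<in> roots"
    using rootsI[OF H_dual_closed(3)[OF \<alpha>(3)] y(1)] y(2) form_zero_right by metis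
  moreover have "dual_form (- \<alpha>) (- \<alpha>) = dual_form \<alpha> \<alpha>"
    using dual_form_minus[OF \<alpha>(3) H_dual_closed(3)[OF \<alpha>(3)]] dual_form_minus[OF \<alpha>(3,3)]
      dual_form_symmetric[of \<alpha> "- \<alpha>"] by simp
  ultimately show ?thesis
    using \<alpha>(2) by (simp add: nonisotropic_roots_iff)
qed

section \<open>The sl2-triples of non-isotropic roots\<close>

definition cartan_coeff :: "('e \<Rightarrow> complex) \<Rightarrow> ('e \<Rightarrow> complex) \<Rightarrow> complex" where
  "cartan_coeff \<alpha> \<beta> = 2 * dual_form \<alpha> \<beta> / dual_form \<alpha> \<alpha>"

lemma reflection_eq: "reflection \<alpha> \<beta> = \<beta> - complex_scale (cartan_coeff \<alpha> \<beta>) \<alpha>"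
  by (simp add: reflection_def cartan_coeff_def)

definition coroot :: "('e \<Rightarrow> complex) \<Rightarrow> 'e" where
  "coroot \<alpha> = (2 / dual_form \<alpha> \<alpha>) *s t_elem \<alpha>"

lemma coroot_weight:
  assumes "\<alpha> \<in> H_dual" "\<beta> \<in> H_dual" "x \<in> root_space \<beta>"
  shows "bracket (coroot \<alpha>) x = cartan_coeff \<alpha> \<beta> *s x"
  using root_spaceD[OF assms(3) t_elem(1)[OF assms(1)]] dual_form_eq[OF assms(1,2)]
  by (simp add: coroot_def bracket_scale_left cartan_coeff_def)

text \<open>The partner \<open>f\<close> is any vector of the opposite root space that pairs non-trivially with
  \<open>e\<close>, scaled so that the bracket is the coroot.\<close>

lemma sl2_triple_of_root:
  assumes "\<alpha> \<in> nonisotropic_roots" "e \<in> root_space \<alpha>" "e \<noteq> 0"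
  obtains f where "f \<in> root_space (- \<alpha>)" "sl2_triple e (coroot \<alpha>) f"
proof -
  have \<alpha>: "dual_form \<alpha> \<alpha> \<noteq> 0" "\<alpha> \<in> H_dual"
    using assms(1) roots_subset_H_dual by (auto simp: nonisotropic_roots_iff)
  obtain y where y: "y \<in> root_space (- \<alpha>)" "form e y \<noteq> 0"
    using root_space_pairing_nondegenerate[OF \<alpha>(2) assms(2,3)] .
  define f where "f = (2 / (dual_form \<alpha> \<alpha> * form e y)) *s y"
  have f: "f \<in> root_space (- \<alpha>)"
    unfolding f_def using subspace_scale[OF subspace_root_space] y(1) .
  have "form e f = 2 / dual_form \<alpha> \<alpha>"
    using y(2) by (simp add: f_def form_scale_right)
  hence ef: "bracket e f = coroot \<alpha>"
    using bracket_opposite_root_vectors[OF \<alpha>(2) assms(2) f] by (simp add: coroot_def)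
  have "cartan_coeff \<alpha> \<alpha> = 2"
    using \<alpha>(1) by (simp add: cartan_coeff_def)
  moreover have "cartan_coeff \<alpha> (- \<alpha>) = - 2"
    using \<alpha> dual_form_minus[OF \<alpha>(2,2)] by (simp add: cartan_coeff_def dual_form_symmetric[of \<alpha> "- \<alpha>"])
  ultimately have "sl2_triple e (coroot \<alpha>) f"
    using ef coroot_weight[OF \<alpha>(2,2) assms(2)] coroot_weight[OF \<alpha>(2) H_dual_closed(3)[OF \<alpha>(2)] f]
    by (simp add: sl2_triple_def)
  with f show ?thesis
    by (rule that)
qed

lemma root_lowering_nonzero:
  assumes "\<alpha> \<in> nonisotropic_roots" "e \<in> root_space \<alpha>" "sl2_triple e (coroot \<alpha>) f"
    and "\<beta> \<in> H_dual" "x \<in> root_space \<beta>" "x \<noteq> 0" "cartan_coeff \<alpha> \<beta> = of_nat n"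
  shows "(bracket f ^^ n) x \<noteq> 0"
proof -
  have \<alpha>: "\<alpha> \<in> H_dual"
    using assms(1) roots_subset_H_dual nonisotropic_roots_iff by blast
  obtain k where "(bracket e ^^ k) x = 0"
    using ad_locally_nilpotent[OF assms(1,2)] by blast
  moreover have "bracket (coroot \<alpha>) x = of_nat n *s x"
    using coroot_weight[OF \<alpha> assms(4,5)] assms(7) by simp
  ultimately show ?thesis
    using sl2_lowering_nonzero[OF assms(3)] assms(6) by blast
qed

lemma cartan_coeff_integral:
  assumes "\<alpha> \<in> nonisotropic_roots" "\<beta> \<in> roots"
  shows "\<exists>n::int. cartan_coeff \<alpha> \<beta> = of_int n"
proof -
  have \<alpha>: "\<alpha> \<in> roots" "\<alpha> \<in> H_dual"
    using assms(1) roots_subset_H_dual nonisotropic_roots_iff by blast+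
  obtain e where e: "e \<in> root_space \<alpha>" "e \<noteq> 0"
    using \<alpha>(1) by (rule root_vector_exists)
  obtain x where x: "x \<in> root_space \<beta>" "x \<noteq> 0"
    using assms(2) by (rule root_vector_exists)
  obtain f where f: "f \<in> root_space (- \<alpha>)" "sl2_triple e (coroot \<alpha>) f"
    using assms(1) e by (rule sl2_triple_of_root)
  obtain k where k: "(bracket e ^^ k) x = 0"
    using ad_locally_nilpotent[OF assms(1) e(1)] by blast
  show ?thesis
    using f(2) coroot_weight[OF \<alpha>(2) roots_subset_H_dual[OF assms(2)] x(1)] x(2) k
      ad_locally_nilpotent[OF uminus_nonisotropic[OF assms(1)] f(1)]
    by (rule sl2_weight_integral)
qed

text \<open>A vector \<open>x\<close> of the root space that commutes with \<open>f\<close> has weight 2 and is killed by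
  \<open>f\<close>, hence vanishes by the lowering lemma. So \<open>x\<close> is determined by its pairing with
  \<open>f\<close>.\<close>

lemma root_space_one_dimensional:
  assumes "\<alpha> \<in> nonisotropic_roots"
  obtains e where "e \<noteq> 0" "root_space \<alpha> = range (\<lambda>c. c *s e)"
proof -
  have \<alpha>: "dual_form \<alpha> \<alpha> \<noteq> 0" "\<alpha> \<in> H_dual" "\<alpha> \<in> roots"
    using assms roots_subset_H_dual by (auto simp: nonisotropic_roots_iff)
  obtain e where e: "e \<in> root_space \<alpha>" "e \<noteq> 0"
    using \<alpha>(3) by (rule root_vector_exists)
  obtain f where f: "f \<in> root_space (- \<alpha>)" "sl2_triple e (coroot \<alpha>) f"
    using assms e by (rule sl2_triple_of_root)
  have zero: "x = 0" if x: "x \<in> root_space \<alpha>" and fx: "bracket x f = 0" for x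
  proof (rule ccontr)
    assume "x \<noteq> 0"
    have "cartan_coeff \<alpha> \<alpha> = of_nat 2"
      using \<alpha>(1) by (simp add: cartan_coeff_def)
    with assms e(1) f(2) \<alpha>(2) x \<open>x \<noteq> 0\<close> have "(bracket f ^^ 2) x \<noteq> 0"
      by (rule root_lowering_nonzero)
    moreover have "bracket f x = 0"
      using fx bracket_antisym[of f x] by simp
    ultimately show False
      by (simp add: numeral_2_eq_2)
  qed
  have ef: "form e f \<noteq> 0"
    using zero[OF e(1)] e(2) bracket_opposite_root_vectors[OF \<alpha>(2) e(1) f(1)] by auto
  have "x \<in> range (\<lambda>c. c *s e)" if x: "x \<in> root_space \<alpha>" for x
  proof -
    let ?y = "x - (form x f / form e f) *s e"
    have y: "?y \<in> root_space \<alpha>"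
      by (rule subspace_diff[OF subspace_root_space x subspace_scale[OF subspace_root_space e(1)]])
    have "form ?y f = 0"
      using ef by (simp add: form_symmetric[of _ f] form_diff_right form_scale_right)
    hence "?y = 0"
      using zero[OF y] bracket_opposite_root_vectors[OF \<alpha>(2) y f(1)] by simp
    thus ?thesis by (auto simp: image_iff)
  qed
  moreover have "c *s e \<in> root_space \<alpha>" for c
    by (rule subspace_scale[OF subspace_root_space e(1)])
  ultimately have "root_space \<alpha> = range (\<lambda>c. c *s e)"
    by blast
  with e(2) show ?thesis
    by (rule that)
qed

section \<open>Reflections and orbits\<close>

lemma nonisotropicD:
  assumes "\<alpha> \<in> nonisotropic_roots"
  shows "\<alpha> \<in> roots" "\<alpha> \<in> H_dual" "dual_form \<alpha> \<alpha> \<noteq> 0"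
  using assms roots_subset_H_dual by (auto simp: nonisotropic_roots_iff)

lemma reflection_in_H_dual:
  assumes "\<alpha> \<in> nonisotropic_roots" "\<beta> \<in> H_dual"
  shows "reflection \<alpha> \<beta> \<in> H_dual"
  unfolding reflection_eq
  by (intro H_dual_closed(2)[OF assms(2)] H_dual_closed(4)[OF nonisotropicD(2)[OF assms(1)]])

lemma cartan_coeff_reflection:
  assumes "\<alpha> \<in> nonisotropic_roots" "\<beta> \<in> H_dual"
  shows "cartan_coeff \<alpha> (reflection \<alpha> \<beta>) = - cartan_coeff \<alpha> \<beta>"
proof -
  note \<alpha> = nonisotropicD[OF assms(1)]
  have "dual_form \<alpha> (reflection \<alpha> \<beta>) = dual_form \<alpha> \<beta> - cartan_coeff \<alpha> \<beta> * dual_form \<alpha> \<alpha>"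
    unfolding reflection_eq by (rule dual_form_reflected[OF \<alpha>(2) assms(2) \<alpha>(2)])
  also have "\<dots> = - dual_form \<alpha> \<beta>"
    using \<alpha>(3) by (simp add: cartan_coeff_def)
  finally show ?thesis
    by (simp add: cartan_coeff_def)
qed

lemma reflection_involutive:
  assumes "\<alpha> \<in> nonisotropic_roots" "\<beta> \<in> H_dual"
  shows "reflection \<alpha> (reflection \<alpha> \<beta>) = \<beta>"
  unfolding reflection_eq[of \<alpha> "reflection \<alpha> \<beta>"] cartan_coeff_reflection[OF assms]
  unfolding reflection_eq by (rule ext) (simp add: complex_scale_def)

lemma reflection_Bij:
  assumes "\<alpha> \<in> nonisotropic_roots"
  shows "restrict (reflection \<alpha>) H_dual \<in> Bij H_dual"
proof -
  have "bij_betw (reflection \<alpha>) H_dual H_dual"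
    by (rule bij_betw_byWitness[where f' = "reflection \<alpha>"])
      (use reflection_in_H_dual[OF assms] reflection_involutive[OF assms] in auto)
  thus ?thesis
    by (simp add: Bij_def)
qed

lemma inv_reflection:
  assumes "\<alpha> \<in> nonisotropic_roots"
  shows "m_inv (BijGroup H_dual) (restrict (reflection \<alpha>) H_dual) = restrict (reflection \<alpha>) H_dual"
proof (rule group.inv_equality[OF group_BijGroup])
  have "compose H_dual (restrict (reflection \<alpha>) H_dual) (restrict (reflection \<alpha>) H_dual) = (\<lambda>x\<in>H_dual. x)"
    by (rule ext) (simp add: compose_def reflection_in_H_dual[OF assms] reflection_involutive[OF assms])
  thus "restrict (reflection \<alpha>) H_dual \<otimes>\<^bsub>BijGroup H_dual\<^esub> restrict (reflection \<alpha>) H_dual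
      = \<one>\<^bsub>BijGroup H_dual\<^esub>"
    using reflection_Bij[OF assms] by (simp add: BijGroup_def)
qed (use reflection_Bij[OF assms] in \<open>simp_all add: BijGroup_def\<close>)

text \<open>Inverses of reflections preserve \<open>X\<close> as well, because a reflection is its own inverse.\<close>

lemma weyl_group_preserves:
  assumes "P \<subseteq> nonisotropic_roots" "X \<subseteq> H_dual"
    and "\<And>\<alpha> \<beta>. \<alpha> \<in> P \<Longrightarrow> \<beta> \<in> X \<Longrightarrow> reflection \<alpha> \<beta> \<in> X"
    and "w \<in> weyl_group P"
  shows "w \<in> Bij H_dual \<and> (\<forall>\<beta>\<in>X. w \<beta> \<in> X)"
proof -
  have gen: "restrict (reflection \<alpha>) H_dual \<in> Bij H_dual \<and>
      (\<forall>\<beta>\<in>X. restrict (reflection \<alpha>) H_dual \<beta> \<in> X)"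
    and inv_gen: "m_inv (BijGroup H_dual) (restrict (reflection \<alpha>) H_dual) = restrict (reflection \<alpha>) H_dual"
    if "\<alpha> \<in> P" for \<alpha>
  proof -
    have \<alpha>: "\<alpha> \<in> nonisotropic_roots"
      using that assms(1) by blast
    have "restrict (reflection \<alpha>) H_dual \<beta> \<in> X" if "\<beta> \<in> X" for \<beta>
    proof -
      have "\<beta> \<in> H_dual"
        using that assms(2) by blast
      thus ?thesis
        using assms(3)[OF \<open>\<alpha> \<in> P\<close> that] by simp
    qed
    thus "restrict (reflection \<alpha>) H_dual \<in> Bij H_dual \<and>
        (\<forall>\<beta>\<in>X. restrict (reflection \<alpha>) H_dual \<beta> \<in> X)"
      using reflection_Bij[OF \<alpha>] by blast
    show "m_inv (BijGroup H_dual) (restrict (reflection \<alpha>) H_dual) = restrict (reflection \<alpha>) H_dual"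
      by (rule inv_reflection[OF \<alpha>])
  qed
  show ?thesis
    using assms(4) unfolding weyl_group_def
  proof (induction rule: generate.induct)
    case one
    have one: "\<one>\<^bsub>BijGroup H_dual\<^esub> = (\<lambda>x\<in>H_dual. x)"
      by (simp add: BijGroup_def)
    show ?case
      unfolding one
    proof
      show "(\<lambda>x\<in>H_dual. x) \<in> Bij H_dual"
        by (rule id_Bij)
      show "\<forall>\<beta>\<in>X. (\<lambda>x\<in>H_dual. x) \<beta> \<in> X"
        using assms(2) by auto
    qed
  next
    case (incl h)
    then obtain \<alpha> where "\<alpha> \<in> P" "h = restrict (reflection \<alpha>) H_dual"
      by blast
    thus ?case
      using gen by metis
  next
    case (inv h)
    then obtain \<alpha> where "\<alpha> \<in> P" "h = restrict (reflection \<alpha>) H_dual"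
      by blast
    thus ?case
      using gen inv_gen by metis
  next
    case (eng h1 h2)
    hence mult: "h1 \<otimes>\<^bsub>BijGroup H_dual\<^esub> h2 = compose H_dual h1 h2"
      by (simp add: BijGroup_def)
    have "compose H_dual h1 h2 \<in> Bij H_dual"
      using eng by (intro compose_Bij) blast+
    moreover have "compose H_dual h1 h2 \<beta> \<in> X" if "\<beta> \<in> X" for \<beta>
    proof -
      have "compose H_dual h1 h2 \<beta> = h1 (h2 \<beta>)"
        using that assms(2) by (intro compose_eq) blast
      thus ?thesis
        using eng that by simp
    qed
    ultimately show ?case
      unfolding mult by blast
  qed
qed

text \<open>Every non-isotropic root is obtained from an element of a reflectable base by reflections in
  elements of the base, so whatever holds on the base and survives these reflections holds on all
  non-isotropic roots.\<close>

lemma reflectable_base_induct: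
  assumes "reflectable_base P" "\<beta> \<in> nonisotropic_roots"
    and base: "\<And>\<alpha>. \<alpha> \<in> P \<Longrightarrow> Q \<alpha>"
    and step: "\<And>\<alpha> \<beta>. \<alpha> \<in> P \<Longrightarrow> \<beta> \<in> nonisotropic_roots \<Longrightarrow> Q \<beta> \<Longrightarrow>
      reflection \<alpha> \<beta> \<in> nonisotropic_roots \<and> Q (reflection \<alpha> \<beta>)"
  shows "Q \<beta>"
proof -
  define X where "X = {\<beta> \<in> nonisotropic_roots. Q \<beta>}"
  have P: "P \<subseteq> nonisotropic_roots" "weyl_orbit P = nonisotropic_roots"
    using assms(1) by (simp_all add: reflectable_base_def)
  obtain w \<alpha> where w: "w \<in> weyl_group P" "\<alpha> \<in> P" "\<beta> = w \<alpha>"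
    using assms(2) unfolding P(2)[symmetric] weyl_orbit_def by blast
  have "X \<subseteq> H_dual"
    using nonisotropicD(2) by (auto simp: X_def)
  moreover have "\<alpha> \<in> X"
    using w(2) P(1) base by (auto simp: X_def)
  moreover have "reflection \<alpha> \<beta> \<in> X" if "\<alpha> \<in> P" "\<beta> \<in> X" for \<alpha> \<beta>
    using step that by (simp add: X_def)
  ultimately have "w \<alpha> \<in> X"
    using weyl_group_preserves[OF P(1) _ _ w(1), of X] by blast
  thus ?thesis
    by (simp add: w(3) X_def)
qed

section \<open>Eigenvalues of Cartan automorphisms\<close>

lemma cartan_automorphismD:
  assumes "cartan_automorphism \<Psi>"
  shows "\<Psi> (c *s x) = c *s \<Psi> x" "\<Psi> (bracket x y) = bracket (\<Psi> x) (\<Psi> y)"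
    "h \<in> H \<Longrightarrow> \<Psi> h = h" "x \<noteq> 0 \<Longrightarrow> \<Psi> x \<noteq> 0"
proof -
  have \<Psi>: "bij \<Psi>" "\<And>c x. \<Psi> (c *s x) = c *s \<Psi> x"
    using assms by (auto simp: cartan_automorphism_def lie_automorphism_def)
  show "\<Psi> (c *s x) = c *s \<Psi> x" "\<Psi> (bracket x y) = bracket (\<Psi> x) (\<Psi> y)"
    "h \<in> H \<Longrightarrow> \<Psi> h = h"
    using assms by (auto simp: cartan_automorphism_def lie_automorphism_def)
  have "\<Psi> 0 = 0"
    using \<Psi>(2)[of 0 0] by simp
  thus "x \<noteq> 0 \<Longrightarrow> \<Psi> x \<noteq> 0"
    using bij_is_inj[OF \<Psi>(1)] injD by metis
qed

lemma eta_eqI: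
  assumes "cartan_automorphism \<Psi>" "\<alpha> \<in> nonisotropic_roots"
    and "x \<in> root_space \<alpha>" "x \<noteq> 0" "\<Psi> x = c *s x"
  shows "eta \<Psi> \<alpha> = c"
proof -
  obtain e where e: "e \<noteq> 0" "root_space \<alpha> = range (\<lambda>c. c *s e)"
    using assms(2) by (rule root_space_one_dimensional)
  obtain d where d: "x = d *s e"
    using assms(3) e(2) by blast
  show ?thesis
    unfolding eta_def
  proof (rule the_equality)
    show "\<forall>y\<in>root_space \<alpha>. \<Psi> y = c *s y"
    proof
      fix y assume "y \<in> root_space \<alpha>"
      then obtain b where "y = b *s e"
        using e(2) by blast
      hence y: "y = (b / d) *s x"
        using d assms(4) by auto
      show "\<Psi> y = c *s y"
        unfolding y cartan_automorphismD(1)[OF assms(1)] assms(5) by (simp add: mult.commute)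
    qed
    show "b = c" if "\<forall>y\<in>root_space \<alpha>. \<Psi> y = b *s y" for b
      using that assms(3-5) scale_cancel_right by metis
  qed
qed

lemma cartan_automorphism_acts_by_eta:
  assumes "cartan_automorphism \<Psi>" "\<alpha> \<in> nonisotropic_roots" "x \<in> root_space \<alpha>"
  shows "\<Psi> x = eta \<Psi> \<alpha> *s x"
proof (cases "x = 0")
  case True
  thus ?thesis
    using cartan_automorphismD(1)[OF assms(1), of 0 0] by simp
next
  case False
  have "\<Psi> x \<in> root_space \<alpha>"
  proof (rule root_spaceI)
    fix h assume h: "h \<in> H"
    have "bracket h (\<Psi> x) = \<Psi> (bracket h x)"
      by (simp add: cartan_automorphismD(2,3)[OF assms(1)] h)
    thus "bracket h (\<Psi> x) = \<alpha> h *s \<Psi> x"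
      by (simp add: root_spaceD[OF assms(3) h] cartan_automorphismD(1)[OF assms(1)])
  qed
  moreover obtain e where e: "e \<noteq> 0" "root_space \<alpha> = range (\<lambda>c. c *s e)"
    using assms(2) by (rule root_space_one_dimensional)
  ultimately obtain b c where "\<Psi> x = b *s e" "x = c *s e"
    using assms(3) by blast
  hence scalar: "\<Psi> x = (b / c) *s x"
    using False by auto
  show ?thesis
    using eta_eqI[OF assms False scalar] scalar by simp
qed

lemma eta_nonzero:
  assumes "cartan_automorphism \<Psi>" "\<alpha> \<in> nonisotropic_roots"
  shows "eta \<Psi> \<alpha> \<noteq> 0"
proof -
  obtain x where x: "x \<in> root_space \<alpha>" "x \<noteq> 0"
    using nonisotropicD(1)[OF assms(2)] by (rule root_vector_exists)
  have "eta \<Psi> \<alpha> *s x \<noteq> 0"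
    using cartan_automorphism_acts_by_eta[OF assms x(1)] cartan_automorphismD(4)[OF assms(1) x(2)]
    by simp
  thus ?thesis by auto
qed

text \<open>The bracket of opposite root vectors can be taken to be the coroot, which a Cartan automorphism
  fixes.\<close>

lemma eta_minus:
  assumes "cartan_automorphism \<Psi>" "\<alpha> \<in> nonisotropic_roots"
  shows "eta \<Psi> (- \<alpha>) = inverse (eta \<Psi> \<alpha>)"
proof -
  note \<alpha> = nonisotropicD[OF assms(2)] and \<alpha>' = uminus_nonisotropic[OF assms(2)]
  obtain e where e: "e \<in> root_space \<alpha>" "e \<noteq> 0"
    using \<alpha>(1) by (rule root_vector_exists)
  obtain f where f: "f \<in> root_space (- \<alpha>)" "sl2_triple e (coroot \<alpha>) f"
    using assms(2) e by (rule sl2_triple_of_root)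
  have coroot: "bracket e f = coroot \<alpha>" "coroot \<alpha> \<in> H" "coroot \<alpha> \<noteq> 0"
  proof -
    show "bracket e f = coroot \<alpha>"
      using f(2) by (simp add: sl2_triple_def)
    show "coroot \<alpha> \<in> H"
      unfolding coroot_def by (rule subspace_scale[OF subspace_H t_elem(1)[OF \<alpha>(2)]])
    have "2 *s e \<noteq> 0"
      using e(2) by simp
    thus "coroot \<alpha> \<noteq> 0"
      using f(2) unfolding sl2_triple_def by (metis bracket_zero_left)
  qed
  have "coroot \<alpha> = bracket (\<Psi> e) (\<Psi> f)"
    using cartan_automorphismD(2)[OF assms(1), of e f] cartan_automorphismD(3)[OF assms(1) coroot(2)]
      coroot(1) by simp
  also have "\<dots> = (eta \<Psi> \<alpha> * eta \<Psi> (- \<alpha>)) *s coroot \<alpha>"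
    by (simp add: cartan_automorphism_acts_by_eta[OF assms e(1)] bracket_scale_left
        cartan_automorphism_acts_by_eta[OF assms(1) \<alpha>' f(1)] bracket_scale_right coroot(1))
  finally have "1 *s coroot \<alpha> = (eta \<Psi> \<alpha> * eta \<Psi> (- \<alpha>)) *s coroot \<alpha>"
    by (simp only: scale_one)
  hence "1 = eta \<Psi> \<alpha> * eta \<Psi> (- \<alpha>)"
    using coroot(3) scale_cancel_right by blast
  thus ?thesis
    using inverse_unique by metis
qed

text \<open>Let \<open>x\<close> be a root vector for \<open>\<beta>\<close> and \<open>f\<close> one for \<open>-\<alpha>\<close>. Applying \<open>f\<close> to
  \<open>x\<close> as often as the Cartan integer prescribes gives a nonzero vector for the reflected root. Hence
  that root exists, and the automorphism scales the vector by the corresponding product of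
  eigenvalues.\<close>

lemma eta_reflection_nat:
  assumes "cartan_automorphism \<Psi>" "\<alpha> \<in> nonisotropic_roots" "\<beta> \<in> nonisotropic_roots"
    and "cartan_coeff \<alpha> \<beta> = of_nat n"
  shows "reflection \<alpha> \<beta> \<in> nonisotropic_roots \<and>
    eta \<Psi> (reflection \<alpha> \<beta>) = eta \<Psi> \<beta> * eta \<Psi> (- \<alpha>) ^ n"
proof -
  note \<alpha> = nonisotropicD[OF assms(2)] and \<beta> = nonisotropicD[OF assms(3)]
  obtain e where e: "e \<in> root_space \<alpha>" "e \<noteq> 0"
    using \<alpha>(1) by (rule root_vector_exists)
  obtain f where f: "f \<in> root_space (- \<alpha>)" "sl2_triple e (coroot \<alpha>) f"
    using assms(2) e by (rule sl2_triple_of_root)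
  obtain x where x: "x \<in> root_space \<beta>" "x \<noteq> 0"
    using \<beta>(1) by (rule root_vector_exists)
  define \<gamma> where "\<gamma> = reflection \<alpha> \<beta>"
  have \<gamma>: "\<gamma> \<in> H_dual"
    unfolding \<gamma>_def by (rule reflection_in_H_dual[OF assms(2) \<beta>(2)])
  have "\<gamma> = \<beta> + complex_scale (of_nat n) (- \<alpha>)"
    unfolding \<gamma>_def reflection_eq assms(4) by (rule ext) (simp add: complex_scale_def)
  hence y: "(bracket f ^^ n) x \<in> root_space \<gamma>"
    using funpow_bracket_root_space[OF f(1) x(1), of n] by simp
  have y0: "(bracket f ^^ n) x \<noteq> 0"
    using assms(2) e(1) f(2) \<beta>(2) x assms(4) by (rule root_lowering_nonzero)
  have \<gamma>_eq: "\<gamma> = \<beta> - complex_scale (cartan_coeff \<alpha> \<beta>) \<alpha>"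
    unfolding \<gamma>_def by (rule reflection_eq)
  have expand: "dual_form \<delta> \<gamma> = dual_form \<delta> \<beta> - cartan_coeff \<alpha> \<beta> * dual_form \<delta> \<alpha>"
    if "\<delta> \<in> H_dual" for \<delta>
    unfolding \<gamma>_eq by (rule dual_form_reflected[OF \<alpha>(2) \<beta>(2) that])
  have "dual_form \<gamma> \<gamma> = dual_form \<beta> \<gamma> - cartan_coeff \<alpha> \<beta> * dual_form \<alpha> \<gamma>"
    using expand[OF \<gamma>] dual_form_symmetric[of \<gamma> \<alpha>] dual_form_symmetric[of \<gamma> \<beta>] by argo
  also have "\<dots> = dual_form \<beta> \<beta> - cartan_coeff \<alpha> \<beta> * dual_form \<beta> \<alpha>
      - cartan_coeff \<alpha> \<beta> * (dual_form \<alpha> \<beta> - cartan_coeff \<alpha> \<beta> * dual_form \<alpha> \<alpha>)"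
    unfolding expand[OF \<alpha>(2)] expand[OF \<beta>(2)] ..
  also have "\<dots> = dual_form \<beta> \<beta>"
    using \<alpha>(3) by (simp add: cartan_coeff_def dual_form_symmetric[of \<beta> \<alpha>])
  finally have "dual_form \<gamma> \<gamma> = dual_form \<beta> \<beta>" .
  hence \<gamma>_root: "\<gamma> \<in> nonisotropic_roots"
    using rootsI[OF \<gamma> y y0] \<beta>(3) by (simp add: nonisotropic_roots_iff)
  define d where "d = eta \<Psi> (- \<alpha>)"
  have "\<Psi> ((bracket f ^^ m) x) = (eta \<Psi> \<beta> * d ^ m) *s (bracket f ^^ m) x" for m
  proof (induction m)
    case 0
    show ?case
      using cartan_automorphism_acts_by_eta[OF assms(1,3) x(1)] by simp
  next
    case (Suc m)
    have \<Psi>f: "\<Psi> f = d *s f"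
      unfolding d_def
      by (rule cartan_automorphism_acts_by_eta[OF assms(1) uminus_nonisotropic[OF assms(2)] f(1)])
    show ?case
      by (simp add: cartan_automorphismD(2)[OF assms(1)] Suc \<Psi>f bracket_scale_left
          bracket_scale_right mult.left_commute mult.commute)
  qed
  hence "eta \<Psi> \<gamma> = eta \<Psi> \<beta> * eta \<Psi> (- \<alpha>) ^ n"
    using eta_eqI[OF assms(1) \<gamma>_root y y0] unfolding d_def by blast
  thus ?thesis
    using \<gamma>_root by (simp add: \<gamma>_def)
qed

text \<open>Thus the eigenvalues transform under reflections exactly as the values of a homomorphism on the
  root lattice do. A negative Cartan integer becomes a positive one when \<open>\<alpha>\<close> is replaced by
  \<open>-\<alpha>\<close>.\<close>

lemma eta_reflection:
  assumes "cartan_automorphism \<Psi>" "\<alpha> \<in> nonisotropic_roots" "\<beta> \<in> nonisotropic_roots"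
    and n: "cartan_coeff \<alpha> \<beta> = of_int n"
  shows "reflection \<alpha> \<beta> \<in> nonisotropic_roots \<and>
    eta \<Psi> (reflection \<alpha> \<beta>) = eta \<Psi> \<beta> * eta \<Psi> \<alpha> powi (- n)"
proof (cases "n \<ge> 0")
  case True
  hence m: "n = int (nat n)"
    by simp
  hence "cartan_coeff \<alpha> \<beta> = of_nat (nat n)"
    using n by (metis of_int_of_nat_eq)
  moreover have "eta \<Psi> (- \<alpha>) ^ nat n = eta \<Psi> \<alpha> powi (- n)"
    using True by (simp add: eta_minus[OF assms(1,2)] power_int_def)
  ultimately show ?thesis
    using eta_reflection_nat[OF assms(1-3)] by simp
next
  case False
  note \<alpha> = nonisotropicD[OF assms(2)] and \<beta> = nonisotropicD[OF assms(3)]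
    and \<alpha>' = uminus_nonisotropic[OF assms(2)]
  have dual: "dual_form (- \<alpha>) (- \<alpha>) = dual_form \<alpha> \<alpha>"
    using dual_form_minus[OF \<alpha>(2) H_dual_closed(3)[OF \<alpha>(2)]] dual_form_minus[OF \<alpha>(2,2)]
      dual_form_symmetric[of \<alpha> "- \<alpha>"] by simp
  have coeff: "cartan_coeff (- \<alpha>) \<beta> = - cartan_coeff \<alpha> \<beta>"
    by (simp add: cartan_coeff_def dual dual_form_minus[OF \<alpha>(2) \<beta>(2)])
  have "reflection (- \<alpha>) \<beta> = reflection \<alpha> \<beta>"
    unfolding reflection_eq coeff by (rule ext) (simp add: complex_scale_def)
  moreover have "cartan_coeff (- \<alpha>) \<beta> = of_nat (nat (- n))"
    using False n coeff by simp
  moreover have "eta \<Psi> (- (- \<alpha>)) ^ nat (- n) = eta \<Psi> \<alpha> powi (- n)"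
    using False by (simp add: power_int_def)
  ultimately show ?thesis
    using eta_reflection_nat[OF assms(1) \<alpha>' assms(3)] by simp
qed

section \<open>Reflectable bases in index zero\<close>

text \<open>An infinite infimum would make the index infinite; a finite one is attained, as the extended
  naturals are well-ordered.\<close>

lemma ind_zero_imp_reflectable_base:
  assumes "ind = 0"
  obtains P where "finite P" "reflectable_base P" "card P = int_rank (int_span roots)"
proof -
  let ?S = "{enat (card P) | P. finite P \<and> reflectable_base P}"
  let ?r = "int_rank (int_span roots)"
  have ind: "ereal_of_enat (Inf ?S) - ereal (real ?r) = 0"
    using assms by (simp only: ind_def refl_number_def)
  have "?S \<noteq> {}"
  proof
    assume "?S = {}"
    hence "Inf ?S = \<infinity>"
      by (simp add: Inf_enat_def)
    thus False
      using ind by simp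
  qed
  then obtain k where "k \<in> ?S"
    by blast
  hence "Inf ?S \<in> ?S"
    unfolding Inf_enat_def by (metis (mono_tags, lifting) LeastI empty_iff)
  then obtain P where P: "finite P" "reflectable_base P" "Inf ?S = enat (card P)"
    by blast
  have "card P = ?r"
    using ind unfolding P(3) by simp
  with P(1,2) show ?thesis
    by (rule that)
qed

lemma reflection_eq_int:
  "cartan_coeff \<alpha> \<beta> = of_int n \<Longrightarrow> reflection \<alpha> \<beta> = \<beta> + int_scale (- n) \<alpha>"
  unfolding reflection_eq by (rule ext) (simp add: complex_scale_def int_scale_def)

text \<open>Reflections in base elements add integer multiples of base elements.\<close>

lemma nonisotropic_root_in_int_span:
  assumes "reflectable_base P" "\<beta> \<in> nonisotropic_roots"
  shows "\<beta> \<in> int_span P"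
  using assms
proof (rule reflectable_base_induct[where Q = "\<lambda>\<beta>. \<beta> \<in> int_span P"])
  fix \<alpha> \<beta> assume \<alpha>: "\<alpha> \<in> P" and \<beta>: "\<beta> \<in> nonisotropic_roots" "\<beta> \<in> int_span P"
  have \<alpha>': "\<alpha> \<in> nonisotropic_roots"
    using \<alpha> assms(1) by (auto simp: reflectable_base_def)
  obtain n :: int where n: "cartan_coeff \<alpha> \<beta> = of_int n"
    using cartan_coeff_integral[OF \<alpha>' nonisotropicD(1)[OF \<beta>(1)]] by blast
  \<comment> \<open>The identity is used only to learn that the reflected root is a root.\<close>
  have "cartan_automorphism id"
    by (simp add: cartan_automorphism_def lie_automorphism_def)
  hence "reflection \<alpha> \<beta> \<in> nonisotropic_roots"
    using eta_reflection[OF _ \<alpha>' \<beta>(1) n] by blast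
  moreover have "reflection \<alpha> \<beta> \<in> int_span P"
    unfolding reflection_eq_int[OF n]
    by (rule int_module.span_add[OF \<beta>(2) int_module.span_scale[OF int_module.span_base[OF \<alpha>]]])
  ultimately show "reflection \<alpha> \<beta> \<in> nonisotropic_roots \<and> reflection \<alpha> \<beta> \<in> int_span P"
    by (rule conjI)
next
  show "\<alpha> \<in> int_span P" if "\<alpha> \<in> P" for \<alpha>
    using that by (rule int_module.span_base)
qed

text \<open>The map is the restriction of a homomorphism \<open>\<chi>\<close> on the root lattice. An isotropic root lies
  in the lattice generated by the base because it is a difference of two non-isotropic roots, by the
  very choice of \<open>\<alpha>\<close> in the definition of the map; the same choice gives the value of the map
  there as a product of values of \<open>\<chi>\<close>.\<close>

lemma corresponding_map_root_character:
  assumes "ind = 0" "cartan_automorphism \<Psi>" "corresponding_map \<Psi> \<psi>"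
  shows "root_character \<psi>"
proof -
  obtain P where P: "finite P" "reflectable_base P" "card P = int_rank (int_span roots)"
    using assms(1) by (rule ind_zero_imp_reflectable_base)
  have P_sub: "P \<subseteq> nonisotropic_roots"
    using P(2) by (simp add: reflectable_base_def)
  have nonisotropic: "\<beta> \<in> int_span P" if "\<beta> \<in> nonisotropic_roots" for \<beta>
    using P(2) that by (rule nonisotropic_root_in_int_span)
  have \<psi>: "\<psi> \<alpha> = eta \<Psi> \<alpha>" if "\<alpha> \<in> nonisotropic_roots" for \<alpha>
    using assms(3) that by (simp add: corresponding_map_def)
  have isotropic: "\<exists>\<alpha>\<in>nonisotropic_roots. \<alpha> + \<sigma> \<in> nonisotropic_roots \<and>
      \<psi> \<sigma> = eta \<Psi> (\<alpha> + \<sigma>) * eta \<Psi> (- \<alpha>)" if "\<sigma> \<in> roots" "\<sigma> \<notin> nonisotropic_roots" for \<sigma>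
    using assms(3) that by (simp add: corresponding_map_def nonisotropic_roots_def)
  have roots_span: "\<beta> \<in> int_span P" if "\<beta> \<in> roots" for \<beta>
  proof (cases "\<beta> \<in> nonisotropic_roots")
    case False
    then obtain \<alpha> where "\<alpha> \<in> nonisotropic_roots" "\<alpha> + \<beta> \<in> nonisotropic_roots"
      using isotropic \<open>\<beta> \<in> roots\<close> by blast
    hence "(\<alpha> + \<beta>) - \<alpha> \<in> int_span P"
      by (intro int_module.span_diff nonisotropic)
    thus ?thesis by simp
  qed (rule nonisotropic)
  have "int_span P = int_span roots"
  proof
    show "int_span P \<subseteq> int_span roots"
      using P_sub nonisotropicD(1) by (intro int_module.span_mono) blast
    show "int_span roots \<subseteq> int_span P"
      using roots_span by (intro int_module.span_minimal int_module.subspace_span) blast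
  qed
  hence indep: "int_module.independent P"
    using int_generating_card_rank_imp_independent[OF root_lattice P(1) _ P(3)] by blast
  have eta_P: "eta \<Psi> p \<noteq> 0" if "p \<in> P" for p
    using eta_nonzero[OF assms(2)] P_sub that by blast
  have "\<exists>\<chi>. (\<forall>g. \<chi> g \<noteq> 0) \<and> (\<forall>p\<in>P. \<chi> p = eta \<Psi> p) \<and>
      (\<forall>g\<in>int_span P. \<forall>h\<in>int_span P. \<chi> (g + h) = \<chi> g * \<chi> h) \<and>
      (\<forall>n. \<forall>g\<in>int_span P. \<chi> (int_scale n g) = \<chi> g powi n)"
    using P(1) indep eta_P by (rule int_basis_hom_extension)
  then obtain \<chi> where "(\<forall>g. \<chi> g \<noteq> 0) \<and> (\<forall>p\<in>P. \<chi> p = eta \<Psi> p) \<and>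
      (\<forall>g\<in>int_span P. \<forall>h\<in>int_span P. \<chi> (g + h) = \<chi> g * \<chi> h) \<and>
      (\<forall>n. \<forall>g\<in>int_span P. \<chi> (int_scale n g) = \<chi> g powi n)" ..
  hence \<chi>: "\<And>g. \<chi> g \<noteq> 0" "\<And>p. p \<in> P \<Longrightarrow> \<chi> p = eta \<Psi> p"
    "\<And>g h. g \<in> int_span P \<Longrightarrow> h \<in> int_span P \<Longrightarrow> \<chi> (g + h) = \<chi> g * \<chi> h"
    "\<And>n g. g \<in> int_span P \<Longrightarrow> \<chi> (int_scale n g) = \<chi> g powi n"
    by simp_all
  have \<chi>_eta: "\<chi> \<beta> = eta \<Psi> \<beta>" if "\<beta> \<in> nonisotropic_roots" for \<beta>
    using P(2) that
  proof (rule reflectable_base_induct[where Q = "\<lambda>\<beta>. \<chi> \<beta> = eta \<Psi> \<beta>"])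
    fix \<alpha> \<beta> assume \<alpha>: "\<alpha> \<in> P" and \<beta>: "\<beta> \<in> nonisotropic_roots" "\<chi> \<beta> = eta \<Psi> \<beta>"
    have \<alpha>': "\<alpha> \<in> nonisotropic_roots"
      using \<alpha> P_sub by blast
    obtain n :: int where n: "cartan_coeff \<alpha> \<beta> = of_int n"
      using cartan_coeff_integral[OF \<alpha>' nonisotropicD(1)[OF \<beta>(1)]] by blast
    have "\<chi> (reflection \<alpha> \<beta>) = \<chi> \<beta> * \<chi> (int_scale (- n) \<alpha>)"
      unfolding reflection_eq_int[OF n]
      by (rule \<chi>(3)[OF nonisotropic[OF \<beta>(1)] int_module.span_scale[OF nonisotropic[OF \<alpha>']]])
    also have "\<dots> = eta \<Psi> \<beta> * eta \<Psi> \<alpha> powi (- n)"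
      by (simp only: \<chi>(4)[OF nonisotropic[OF \<alpha>']] \<chi>(2)[OF \<alpha>] \<beta>(2))
    finally show "reflection \<alpha> \<beta> \<in> nonisotropic_roots \<and> \<chi> (reflection \<alpha> \<beta>) = eta \<Psi> (reflection \<alpha> \<beta>)"
      using eta_reflection[OF assms(2) \<alpha>' \<beta>(1) n] by simp
  next
    show "\<chi> \<alpha> = eta \<Psi> \<alpha>" if "\<alpha> \<in> P" for \<alpha>
      using that by (rule \<chi>(2))
  qed
  have \<psi>_\<chi>: "\<psi> \<beta> = \<chi> \<beta>" if "\<beta> \<in> roots" for \<beta>
  proof (cases "\<beta> \<in> nonisotropic_roots")
    case True
    thus ?thesis
      by (simp add: \<psi> \<chi>_eta)
  next
    case False
    then obtain \<alpha> where \<alpha>: "\<alpha> \<in> nonisotropic_roots" "\<alpha> + \<beta> \<in> nonisotropic_roots"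
      "\<psi> \<beta> = eta \<Psi> (\<alpha> + \<beta>) * eta \<Psi> (- \<alpha>)"
      using isotropic \<open>\<beta> \<in> roots\<close> by blast
    note \<alpha>' = uminus_nonisotropic[OF \<alpha>(1)]
    have "\<psi> \<beta> = \<chi> (\<alpha> + \<beta>) * \<chi> (- \<alpha>)"
      by (simp only: \<alpha>(3) \<chi>_eta[OF \<alpha>(2)] \<chi>_eta[OF \<alpha>'])
    also have "\<dots> = \<chi> ((\<alpha> + \<beta>) + (- \<alpha>))"
      by (rule \<chi>(3)[OF nonisotropic[OF \<alpha>(2)] nonisotropic[OF \<alpha>'], symmetric])
    also have "(\<alpha> + \<beta>) + (- \<alpha>) = \<beta>"
      by simp
    finally show ?thesis .
  qed
  show ?thesis
    unfolding root_character_def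
  proof (intro conjI ballI impI)
    fix \<alpha> assume "\<alpha> \<in> roots"
    thus "\<psi> \<alpha> \<noteq> 0"
      using \<psi>_\<chi> \<chi>(1) by simp
  next
    fix \<alpha> \<beta> assume "\<alpha> \<in> roots" "\<beta> \<in> roots" "\<alpha> + \<beta> \<in> roots"
    thus "\<psi> (\<alpha> + \<beta>) = \<psi> \<alpha> * \<psi> \<beta>"
      using \<psi>_\<chi> \<chi>(3) roots_span by simp
  qed
qed

end

theorem proposition4p4p10:
  fixes scale :: "complex \<Rightarrow> 'e::ab_group_add \<Rightarrow> 'e"
    and bracket :: "'e \<Rightarrow> 'e \<Rightarrow> 'e"
    and form :: "'e \<Rightarrow> 'e \<Rightarrow> complex"
    and H :: "'e set"
    and l :: nat
    and \<Psi> :: "'e \<Rightarrow> 'e"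
    and \<psi> :: "('e \<Rightarrow> complex) \<Rightarrow> complex"
  assumes "extended_affine_lie_algebra scale bracket form H"
    and "l \<ge> 2"
    and "lie_algebra_form.type_B scale bracket form H l"
    and "lie_algebra_form.ind scale bracket form H = 0"
    and "lie_algebra_form.cartan_automorphism scale bracket H \<Psi>"
    and "finite_order \<Psi>"
    and "lie_algebra_form.corresponding_map scale bracket form H \<Psi> \<psi>"
  shows "lie_algebra_form.root_character scale bracket H \<psi>"
proof -
  interpret extended_affine_lie_algebra scale bracket form H
    by (rule assms(1))
  show ?thesis
    using assms(4,5,7) by (rule corresponding_map_root_character)
qed

end
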